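(* Let $G$ be a second countable locally compact group, $(\pi,\mathcal H_\pi)$ a projective unitary representation of $G$, $\Lambda\subseteq G$ a Delone set and $\nu$ an invariant Radon probability measure on $\Omega(\Lambda)$. If $\{\pi(\lambda)\psi\}_{\lambda\in\Lambda}$ is a Bessel sequence in $\mathcal H_\pi$ for some $\psi\in\mathcal H_\pi$ with Bessel bound $C_2>0$, then $$\frac{\|C_\psi f\|_{L^2(G)}^2}{\|f\|^2\,\mathrm{covol}_\nu(\Lambda)}\le C_2\quad\text{for all } f\in\mathcal H_\pi\setminus\{0\}.$$ If in addition $\psi\in\mathcal B_\pi$ and $\{\pi(\lambda)\psi\}_{\lambda\in\Lambda}$ has a lower frame bound $C_1>0$, then $$\frac{\|C_\psi f\|_{L^2(G)}^2}{\|f\|^2\,\mathrm{covol}_\nu(\Lambda)}\ge C_1\quad\text{for all } f\in\mathcal H_\pi\setminus\{0\}.$$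
   Context: $G$ is a second countable locally compact group with identity $e_G$ and a fixed left Haar measure $\mu_G$; $L^2(G)$ is with respect to $\mu_G$. A projective unitary representation $(\pi,\mathcal H_\pi)$ is a strongly measurable $\pi:G\to\mathcal U(\mathcal H_\pi)$ with $\pi(e_G)=I$ and $\pi(g_1)\pi(g_2)=\sigma(g_1,g_2)\pi(g_1g_2)$ for some measurable $\sigma:G\times G\to\mathbb T$. $C_\psi f(g)=\langle f,\pi(g)\psi\rangle$. For a fixed compact neighborhood $Q$ of $e_G$, $MF(g)=\sup_{q\in Q}|F(gq)|$, $W(L^2)=\{F\in L^\infty_{loc}(G): MF\in L^2(G)\}$, $\mathcal B_\pi=\{\psi\in\mathcal H_\pi: C_\psi f\in W(L^2)\ \forall f\in\mathcal H_\pi\}$. For $S\subseteq G$, $\Lambda$ is $S$-separated if $\#(\Lambda\cap gS)\le1$ for all $g$, $S$-dense if $\#(\Lambda\cap gS)\ge1$ for all $g$. Delone set: $U$-separated for some nonempty open $U$ and $K$-dense for some compact $K$. $\mathcal C(G)$: closed subsets of $G$ with the Chabauty–Fell topology (neighborhood basis at $C$: $\mathcal V_{K,U}(C)=\{C': C'\cap K\subseteq CU,\ C\cap K\subseteq C'U\}$, $K$ compact, $U$ open neighborhood of $e_G$); $G$ acts by $C\mapsto xC$; hull $\Omega(\Lambda)=\overline{\{x\Lambda:x\in G\}}$. A Radon probability measure $\nu$ on $\Omega(\Lambda)$ is invariant if $\nu(gB)=\nu(B)$ for all $g\in G$ and measurable $B$. $\mathrm{covol}_\nu(\Lambda)\in(0,\infty)$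 is the constant with $\int_{\Omega(\Lambda)}\sum_{\gamma\in\Gamma}f(\gamma)\,d\nu(\Gamma)=\mathrm{covol}_\nu(\Lambda)^{-1}\int_G f\,d\mu_G$ for all $f\in C_c(G)$. *)

theory Defs
  imports "HOL-Analysis.Analysis"
begin

text \<open>The group G is a type of class topological_group_add (group law written additively,
  NOT assumed commutative; identity 0, inverse uminus). Left translate gS = (+) g ` S,
  right translate gq = g + q.\<close>

definition left_translate :: "'g::group_add \<Rightarrow> 'g set \<Rightarrow> 'g set" where
  "left_translate g S = (\<lambda>s. g + s) ` S"

definition set_prod :: "'g::group_add set \<Rightarrow> 'g set \<Rightarrow> 'g set" where
  "set_prod A B = {a + b | a b. a \<in> A \<and> b \<in> B}"

text \<open>Left Haar measure on a second countable LC Hausdorff group (Radon is automatic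
  for locally finite Borel measures in this setting).\<close>
definition left_haar_measure :: "'g::topological_group_add measure \<Rightarrow> bool" where
  "left_haar_measure \<mu> \<longleftrightarrow>
     sets \<mu> = sets borel \<and>
     (\<forall>K. compact K \<longrightarrow> emeasure \<mu> K < \<infinity>) \<and>
     (\<forall>U. open U \<and> U \<noteq> {} \<longrightarrow> emeasure \<mu> U > 0) \<and>
     (\<forall>g B. B \<in> sets borel \<longrightarrow> emeasure \<mu> (left_translate g B) = emeasure \<mu> B)"

definition complex_hilbert :: "(complex \<Rightarrow> 'h::banach \<Rightarrow> 'h) \<Rightarrow> ('h \<Rightarrow> 'h \<Rightarrow> complex) \<Rightarrow> bool" where
  "complex_hilbert cs ip \<longleftrightarrow>
     (\<forall>r x. cs (complex_of_real r) x = r *\<^sub>R x) \<and>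
     (\<forall>a x y. cs a (x + y) = cs a x + cs a y) \<and>
     (\<forall>a b x. cs (a + b) x = cs a x + cs b x) \<and>
     (\<forall>a b x. cs a (cs b x) = cs (a * b) x) \<and>
     (\<forall>x y z. ip (x + y) z = ip x z + ip y z) \<and>
     (\<forall>a x y. ip (cs a x) y = a * ip x y) \<and>
     (\<forall>x y. ip y x = cnj (ip x y)) \<and>
     (\<forall>x. complex_of_real ((norm x)\<^sup>2) = ip x x)"

definition unitary_op :: "(complex \<Rightarrow> 'h::banach \<Rightarrow> 'h) \<Rightarrow> ('h \<Rightarrow> 'h \<Rightarrow> complex) \<Rightarrow> ('h \<Rightarrow> 'h) \<Rightarrow> bool" where
  "unitary_op cs ip U \<longleftrightarrow> bij U \<and>
     (\<forall>a x y. U (cs a x + y) = cs a (U x) + U y) \<and>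
     (\<forall>x y. ip (U x) (U y) = ip x y)"

text \<open>Projective unitary representation; strong measurability = Borel measurability of
  each orbit map g \<mapsto> \<pi>(g)f into the normed space.\<close>
definition proj_unitary_rep ::
  "(complex \<Rightarrow> 'h::banach \<Rightarrow> 'h) \<Rightarrow> ('h \<Rightarrow> 'h \<Rightarrow> complex) \<Rightarrow> ('g::{topological_group_add,second_countable_topology} \<Rightarrow> 'h \<Rightarrow> 'h) \<Rightarrow> bool" where
  "proj_unitary_rep cs ip \<pi> \<longleftrightarrow>
     (\<forall>g. unitary_op cs ip (\<pi> g)) \<and>
     (\<forall>f. (\<lambda>g. \<pi> g f) \<in> borel_measurable borel) \<and>
     \<pi> 0 = id \<and>
     (\<exists>\<sigma> :: 'g \<Rightarrow> 'g \<Rightarrow> complex.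
        (\<lambda>p. \<sigma> (fst p) (snd p)) \<in> borel_measurable borel \<and>
        (\<forall>a b. norm (\<sigma> a b) = 1) \<and>
        (\<forall>a b f. \<pi> a (\<pi> b f) = cs (\<sigma> a b) (\<pi> (a + b) f)))"

definition separated :: "'g::group_add set \<Rightarrow> 'g set \<Rightarrow> bool" where
  "separated S \<Lambda> \<longleftrightarrow> (\<forall>g. finite (\<Lambda> \<inter> left_translate g S) \<and> card (\<Lambda> \<inter> left_translate g S) \<le> 1)"

definition dense_in :: "'g::group_add set \<Rightarrow> 'g set \<Rightarrow> bool" where
  "dense_in S \<Lambda> \<longleftrightarrow> (\<forall>g. \<Lambda> \<inter> left_translate g S \<noteq> {})"

definition delone :: "'g::topological_group_add set \<Rightarrow> bool" where
  "delone \<Lambda> \<longleftrightarrow> (\<exists>U. open U \<and> U \<noteq> {} \<and> separated U \<Lambda>) \<and> (\<exists>K. compact K \<and> dense_in K \<Lambda>)"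

definition cf_nbhd :: "'g::topological_group_add set \<Rightarrow> 'g set \<Rightarrow> 'g set \<Rightarrow> 'g set set" where
  "cf_nbhd K U C = {C'. closed C' \<and> C' \<inter> K \<subseteq> set_prod C U \<and> C \<inter> K \<subseteq> set_prod C' U}"

definition chabauty_fell :: "'g::topological_group_add set topology" where
  "chabauty_fell = topology (\<lambda>W. W \<subseteq> {C. closed C} \<and>
      (\<forall>C\<in>W. \<exists>K U. compact K \<and> open U \<and> 0 \<in> U \<and> cf_nbhd K U C \<subseteq> W))"

definition cf_hull :: "'g::topological_group_add set \<Rightarrow> 'g set set" where
  "cf_hull \<Lambda> = chabauty_fell closure_of (range (\<lambda>x. left_translate x \<Lambda>))"

text \<open>Invariant (Radon) Borel probability measure on the hull (the hull is compact
  metrizable, so Borel probability measures on it are Radon).\<close>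
definition invariant_prob_on_hull :: "'g::topological_group_add set \<Rightarrow> 'g set measure \<Rightarrow> bool" where
  "invariant_prob_on_hull \<Lambda> \<nu> \<longleftrightarrow>
     space \<nu> = cf_hull \<Lambda> \<and>
     sets \<nu> = sigma_sets (cf_hull \<Lambda>) {S. openin (subtopology chabauty_fell (cf_hull \<Lambda>)) S} \<and>
     emeasure \<nu> (space \<nu>) = 1 \<and>
     (\<forall>g B. B \<in> sets \<nu> \<longrightarrow> emeasure \<nu> (left_translate g ` B) = emeasure \<nu> B)"

definition Cc :: "('g::topological_space \<Rightarrow> complex) set" where
  "Cc = {f. continuous_on UNIV f \<and> compact (closure {x. f x \<noteq> 0})}"

definition covol :: "'g::topological_group_add measure \<Rightarrow> 'g set measure \<Rightarrow> real" where
  "covol \<mu> \<nu> = (THE c. 0 < c \<and> (\<forall>f \<in> Cc.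
      (\<integral>\<Gamma>. (\<Sum>\<^sub>\<infinity>\<gamma>\<in>\<Gamma>. f \<gamma>) \<partial>\<nu>) = complex_of_real (1 / c) * (\<integral>x. f x \<partial>\<mu>)))"

definition bessel_seq :: "('h::banach \<Rightarrow> 'h \<Rightarrow> complex) \<Rightarrow> ('g \<Rightarrow> 'h) \<Rightarrow> 'g set \<Rightarrow> real \<Rightarrow> bool" where
  "bessel_seq ip x \<Lambda> C \<longleftrightarrow> (\<forall>f. (\<lambda>l. (cmod (ip f (x l)))\<^sup>2) summable_on \<Lambda> \<and>
      (\<Sum>\<^sub>\<infinity>l\<in>\<Lambda>. (cmod (ip f (x l)))\<^sup>2) \<le> C * (norm f)\<^sup>2)"

definition lower_frame_bound :: "('h::banach \<Rightarrow> 'h \<Rightarrow> complex) \<Rightarrow> ('g \<Rightarrow> 'h) \<Rightarrow> 'g set \<Rightarrow> real \<Rightarrow> bool" where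
  "lower_frame_bound ip x \<Lambda> C \<longleftrightarrow> (\<forall>f. (\<lambda>l. (cmod (ip f (x l)))\<^sup>2) summable_on \<Lambda> \<and>
      C * (norm f)\<^sup>2 \<le> (\<Sum>\<^sub>\<infinity>l\<in>\<Lambda>. (cmod (ip f (x l)))\<^sup>2))"

definition voice_transform :: "('h \<Rightarrow> 'h \<Rightarrow> complex) \<Rightarrow> ('g \<Rightarrow> 'h \<Rightarrow> 'h) \<Rightarrow> 'h \<Rightarrow> 'h \<Rightarrow> 'g \<Rightarrow> complex" where
  "voice_transform ip \<pi> \<psi> f g = ip f (\<pi> g \<psi>)"

definition local_max :: "'g::group_add set \<Rightarrow> ('g \<Rightarrow> complex) \<Rightarrow> 'g \<Rightarrow> ennreal" where
  "local_max Q F g = (SUP q\<in>Q. ennreal (cmod (F (g + q))))"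

definition wiener_L2 :: "'g::topological_group_add measure \<Rightarrow> 'g set \<Rightarrow> ('g \<Rightarrow> complex) \<Rightarrow> bool" where
  "wiener_L2 \<mu> Q F \<longleftrightarrow>
     F \<in> borel_measurable \<mu> \<and>
     (\<forall>K. compact K \<longrightarrow> (\<exists>B. AE g in \<mu>. g \<in> K \<longrightarrow> cmod (F g) \<le> B)) \<and>
     local_max Q F \<in> borel_measurable \<mu> \<and>
     (\<integral>\<^sup>+ g. (local_max Q F g)\<^sup>2 \<partial>\<mu>) < \<infinity>"

definition B_pi :: "'g::topological_group_add measure \<Rightarrow> 'g set \<Rightarrow> ('h \<Rightarrow> 'h \<Rightarrow> complex) \<Rightarrow> ('g \<Rightarrow> 'h \<Rightarrow> 'h) \<Rightarrow> 'h set" where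
  "B_pi \<mu> Q ip \<pi> = {\<psi>. \<forall>f. wiener_L2 \<mu> Q (voice_transform ip \<pi> \<psi> f)}"

definition L2_norm_sq :: "'g measure \<Rightarrow> ('g \<Rightarrow> complex) \<Rightarrow> ennreal" where
  "L2_norm_sq \<mu> F = (\<integral>\<^sup>+ g. ennreal ((cmod (F g))\<^sup>2) \<partial>\<mu>)"

end

theory Submission
  imports Defs
begin

text \<open>
  Counting the points of a random set in the hull defines a left-invariant measure on \<open>G\<close>; by
  uniqueness of Haar measure it is a multiple of \<open>\<mu>\<close>, and the factor is the reciprocal covolume.
  Since the representation is unitary and projective, the frame inequalities for \<open>\<Lambda>\<close> bound the
  sums of \<open>|C\<^sub>\<psi> f|\<^sup>2\<close> over every translate \<open>x\<Lambda>\<close>, uniformly in \<open>x\<close>. Once these bounds are carried over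
  to all elements of the hull, integration against \<open>\<nu>\<close> turns the sums into \<open>\<parallel>C\<^sub>\<psi> f\<parallel>\<^sup>2 / covol\<close>.
  Continuity of \<open>C\<^sub>\<psi> f\<close> is not needed for the passage to the hull: \<open>|C\<^sub>\<psi> f|\<^sup>2\<close> is replaced by its
  average over left translates, which is continuous. The sums of a continuous nonnegative function
  are lower semicontinuous on the hull, which suffices for the upper bound. For the lower bound the
  Wiener amalgam condition makes the tails of the sums uniformly small.
\<close>

subsection \<open>Translates and the Chabauty--Fell topology\<close>

text \<open>The two bounds differ in difficulty because convergence in the hull controls points
  asymmetrically. Every point of a limit set is approached by points of nearby translates of
  \<open>\<Lambda>\<close>, so nonnegative sums can only drop in the limit, and upper bounds
  survive. Conversely, points of the translates inside a compact set must lie near the limit set,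
  but mass far out may escape to infinity; hence the need for tails that are small uniformly over
  all translates. A single open \<open>W\<close> with \<open>0 \<in> W \<subseteq> Q\<close> that
  separates \<open>\<Lambda>\<close> carries all quantitative information: at most one point of each
  hull element in every translate of \<open>W\<close>, finite Haar measure, and comparison with the
  local maximal function. The average is the convolution with a bump function \<open>\<eta>\<close>
  supported in \<open>Q\<close>. Each inequality then acquires the factor
  \<open>\<integral>\<eta>\<close>, which is positive and finite and cancels at the end. The group
  need not be unimodular, so inverses and right translates are never assumed to keep their Haar
  measure. Sums are taken as extended nonnegative integrals over \<open>count_space\<close>, which
  keeps summability out of most arguments.\<close>

lemma borel_measurable_add_group [measurable (raw)]:
  fixes f g :: "'a \<Rightarrow> 'g::{topological_group_add,second_countable_topology}"
  assumes "f \<in> borel_measurable M" "g \<in> borel_measurable M"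
  shows "(\<lambda>x. f x + g x) \<in> borel_measurable M"
  using assms by (rule borel_measurable_continuous_Pair) (intro continuous_intros)

lemma borel_measurable_uminus_group [measurable (raw)]:
  fixes f :: "'a \<Rightarrow> 'g::topological_group_add"
  assumes "f \<in> borel_measurable M"
  shows "(\<lambda>x. - f x) \<in> borel_measurable M"
  by (rule measurable_compose[OF assms borel_measurable_continuous_onI]) (intro continuous_intros)

lemma left_translate_eq_vimage: "left_translate g S = {x. - g + x \<in> S}"
  for g :: "'g::group_add"
proof -
  have "x \<in> (+) g ` S" if "- g + x \<in> S" for x
    using that by (intro image_eqI[of _ _ "- g + x"]) (auto simp: add.assoc[symmetric])
  then show ?thesis
    by (auto simp: left_translate_def add.assoc[symmetric])
qed

lemma mem_left_translate: "x \<in> left_translate g S \<longleftrightarrow> - g + x \<in> S"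
  for g :: "'g::group_add"
  by (simp add: left_translate_eq_vimage)

lemma left_translate_left_translate: "left_translate g (left_translate h S) = left_translate (g + h) S"
  by (simp add: left_translate_def image_image add.assoc)

lemma left_translate_0 [simp]: "left_translate 0 S = S"
  by (simp add: left_translate_def)

lemma left_translate_Int: "left_translate g (A \<inter> B) = left_translate g A \<inter> left_translate g B"
  by (auto simp: mem_left_translate)

lemma left_translate_subset_iff: "left_translate g A \<subseteq> left_translate g B \<longleftrightarrow> A \<subseteq> B"
  by (auto simp: left_translate_def)

lemma left_translate_inverse [simp]:
  "left_translate (- g) (left_translate g S) = S" "left_translate g (left_translate (- g) S) = S"
  by (simp_all add: left_translate_left_translate)

lemma bij_betw_left_translate: "bij_betw ((+) g) S (left_translate g S)"
  for g :: "'g::group_add"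
  by (auto simp: bij_betw_def left_translate_def inj_on_def)

lemma open_left_translate:
  fixes S :: "'g::topological_group_add set"
  assumes "open S" shows "open (left_translate g S)"
proof -
  have "open ((\<lambda>x. - g + x) -` S)"
    using assms by (intro open_vimage continuous_intros)
  then show ?thesis by (simp add: left_translate_eq_vimage vimage_def)
qed

lemma closed_left_translate:
  fixes S :: "'g::topological_group_add set"
  assumes "closed S" shows "closed (left_translate g S)"
proof -
  have "closed ((\<lambda>x. - g + x) -` S)"
    using assms by (intro closed_vimage continuous_intros)
  then show ?thesis by (simp add: left_translate_eq_vimage vimage_def)
qed

lemma compact_left_translate:
  fixes S :: "'g::topological_group_add set"
  assumes "compact S" shows "compact (left_translate g S)"
  unfolding left_translate_def using assms by (intro compact_continuous_image continuous_intros)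

lemma set_prod_left_translate:
  "set_prod (left_translate g A) B = left_translate g (set_prod A B)"
proof (intro equalityI subsetI)
  fix x assume "x \<in> set_prod (left_translate g A) B"
  then obtain a b where "a \<in> A" "b \<in> B" "x = g + (a + b)"
    by (auto simp: set_prod_def left_translate_def add.assoc)
  then show "x \<in> left_translate g (set_prod A B)"
    unfolding set_prod_def left_translate_def by blast
next
  fix x assume "x \<in> left_translate g (set_prod A B)"
  then obtain a b where "a \<in> A" "b \<in> B" "x = (g + a) + b"
    by (auto simp: set_prod_def left_translate_def add.assoc)
  then show "x \<in> set_prod (left_translate g A) B"
    unfolding set_prod_def left_translate_def by blast
qed

lemma compact_set_prod:
  fixes A B :: "'g::topological_group_add set"
  assumes "compact A" "compact B" shows "compact (set_prod A B)"
proof -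
  have "set_prod A B = (\<lambda>p. fst p + snd p) ` (A \<times> B)"
    by (force simp: set_prod_def)
  also have "compact \<dots>"
    using assms by (intro compact_continuous_image compact_Times continuous_intros)
  finally show ?thesis .
qed

lemma finite_disjoint_open_nbhds:
  fixes S :: "'a::t2_space set"
  assumes "finite S"
  obtains V where "\<And>s. s \<in> S \<Longrightarrow> open (V s)" "\<And>s. s \<in> S \<Longrightarrow> s \<in> V s"
    "\<And>s t. s \<in> S \<Longrightarrow> t \<in> S \<Longrightarrow> s \<noteq> t \<Longrightarrow> V s \<inter> V t = {}"
proof -
  have "\<forall>s t :: 'a. \<exists>A B. s \<noteq> t \<longrightarrow> open A \<and> open B \<and> s \<in> A \<and> t \<in> B \<and> A \<inter> B = {}"
    (is "\<forall>s t. ?P s t")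
  proof (intro allI)
    fix s t :: 'a
    show "?P s t" using hausdorff[of s t] by (cases "s = t") simp_all
  qed
  then obtain A B where U: "\<forall>s t :: 'a. s \<noteq> t \<longrightarrow>
      open (A s t) \<and> open (B s t) \<and> s \<in> A s t \<and> t \<in> B s t \<and> A s t \<inter> B s t = {}"
    unfolding choice_iff by blast
  show ?thesis
  \<comment> \<open>The choice of \<open>A s t\<close>, \<open>B s t\<close> depends on the order of
    \<open>s\<close> and \<open>t\<close>. Using both \<open>A s t\<close> and \<open>B t s\<close>
    gives \<open>V s \<subseteq> A s t\<close> and \<open>V t \<subseteq> B s t\<close>, hence
    disjointness.\<close>
  proof (rule that[of "\<lambda>s. \<Inter>t\<in>S - {s}. A s t \<inter> B t s"], goal_cases)
    case (1 s)
    then show ?case using U assms by (intro open_INT open_Int ballI) auto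
  next
    case (2 s)
    have "s \<in> A s t \<inter> B t s" if "t \<noteq> s" for t using U that by (metis IntI)
    then show ?case by auto
  next
    case (3 s t)
    have "A s t \<inter> B s t = {}" using U 3 by blast
    then show ?case using 3 by blast
  qed
qed

text \<open>\<open>topology\<close> can be unfolded only once the defining predicate is known to be
  a topology. For binary intersections, \<open>K \<union> L\<close> and \<open>U \<inter> V\<close>
  serve, since \<open>cf_nbhd K U C\<close> shrinks as \<open>K\<close> grows and \<open>U\<close>
  shrinks.\<close>

lemma openin_chabauty_fell:
  "openin chabauty_fell W \<longleftrightarrow> W \<subseteq> {C. closed C} \<and>
      (\<forall>C\<in>W. \<exists>K U. compact K \<and> open U \<and> 0 \<in> U \<and> cf_nbhd K U C \<subseteq> W)"
  for W :: "'g::topological_group_add set set"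
proof -
  let ?P = "\<lambda>W :: 'g set set. W \<subseteq> {C. closed C} \<and>
      (\<forall>C\<in>W. \<exists>K U. compact K \<and> open U \<and> 0 \<in> U \<and> cf_nbhd K U C \<subseteq> W)"
  have "istopology ?P"
    unfolding istopology_def
  proof (intro conjI allI impI, goal_cases)
    case (1 S T) then show ?case by blast
  next
    case (2 S T)
    show ?case
    proof
      fix C assume C: "C \<in> S \<inter> T"
      obtain K U where KU: "compact K" "open U" "0 \<in> U" "cf_nbhd K U C \<subseteq> S" using 2 C by blast
      obtain L V where LV: "compact L" "open V" "0 \<in> V" "cf_nbhd L V C \<subseteq> T" using 2 C by blast
      have "set_prod A (U \<inter> V) \<subseteq> set_prod A U \<inter> set_prod A V" for A
        by (auto simp: set_prod_def)
      then have "cf_nbhd (K \<union> L) (U \<inter> V) C \<subseteq> cf_nbhd K U C \<inter> cf_nbhd L V C"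
        unfolding cf_nbhd_def by blast
      then show "\<exists>K U. compact K \<and> open U \<and> 0 \<in> U \<and> cf_nbhd K U C \<subseteq> S \<inter> T"
        using KU LV by (intro exI[of _ "K \<union> L"] exI[of _ "U \<inter> V"]) auto
    qed
  next
    case (3 \<K>) then show ?case by blast
  next
    case (4 \<K>)
    show ?case
    proof
      fix C assume "C \<in> \<Union>\<K>"
      then obtain S where "S \<in> \<K>" "C \<in> S" by blast
      then show "\<exists>K U. compact K \<and> open U \<and> 0 \<in> U \<and> cf_nbhd K U C \<subseteq> \<Union>\<K>"
        using 4 by (meson Sup_upper order_trans)
    qed
  qed
  then show ?thesis
    unfolding chabauty_fell_def by (simp add: topology_inverse')
qed

lemma topspace_chabauty_fell [simp]: "topspace chabauty_fell = {C. closed C}"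
proof -
  have "openin chabauty_fell {C. closed C}"
    unfolding openin_chabauty_fell
    by (intro conjI ballI exI[of _ "{}"] exI[of _ UNIV]) (auto simp: cf_nbhd_def)
  then show ?thesis
    by (metis (no_types) openin_chabauty_fell openin_subset openin_topspace subset_antisym)
qed

text \<open>These hit sets and the miss sets of \<open>openin_chabauty_fell_miss\<close> are all
  that the passage to limits uses of the topology: hits give semicontinuity from below, misses
  control from above.\<close>

lemma openin_chabauty_fell_hit:
  fixes V :: "'g::topological_group_add set"
  assumes "open V"
  shows "openin chabauty_fell {C. closed C \<and> C \<inter> V \<noteq> {}}"
  unfolding openin_chabauty_fell
proof (intro conjI ballI)
  fix C assume "C \<in> {C. closed C \<and> C \<inter> V \<noteq> {}}"
  then obtain c where c: "c \<in> C" "c \<in> V" by auto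
  \<comment> \<open>If \<open>c = c' + u\<close> then \<open>c' = c - u\<close>, so this
    \<open>U\<close> is exactly the set of displacements that keep \<open>c'\<close> in
    \<open>V\<close>.\<close>
  define U where "U = (\<lambda>u. c - u) -` V"
  have "open U" unfolding U_def using assms by (intro open_vimage continuous_intros)
  moreover have "0 \<in> U" using c by (simp add: U_def)
  moreover have "cf_nbhd {c} U C \<subseteq> {C. closed C \<and> C \<inter> V \<noteq> {}}"
  proof
    fix C' assume "C' \<in> cf_nbhd {c} U C"
    then have C': "closed C'" "c \<in> set_prod C' U" using c by (auto simp: cf_nbhd_def)
    then obtain c' u where "c' \<in> C'" "u \<in> U" "c = c' + u" by (auto simp: set_prod_def)
    then have "c' \<in> V" by (auto simp: U_def)
    then show "C' \<in> {C. closed C \<and> C \<inter> V \<noteq> {}}" using C' \<open>c' \<in> C'\<close> by blast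
  qed
  ultimately show "\<exists>K U. compact K \<and> open U \<and> 0 \<in> U \<and> cf_nbhd K U C \<subseteq> {C. closed C \<and> C \<inter> V \<noteq> {}}"
    by (intro exI[of _ "{c}"] exI[of _ U]) auto
qed auto

text \<open>One needs a single \<open>U\<close> for which no \<open>k - u\<close> with
  \<open>k\<close> in \<open>K\<close> and \<open>u\<close> in \<open>U\<close> lies in
  \<open>C\<close>. Continuity of subtraction and closedness of \<open>C\<close> give one near each
  point of \<open>K\<close>, and compactness reduces to finitely many.\<close>

lemma openin_chabauty_fell_miss:
  fixes K :: "'g::topological_group_add set"
  assumes "compact K"
  shows "openin chabauty_fell {C. closed C \<and> C \<inter> K = {}}"
  unfolding openin_chabauty_fell
proof (intro conjI ballI)
  fix C assume "C \<in> {C. closed C \<and> C \<inter> K = {}}"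
  then have C: "closed C" "C \<inter> K = {}" by auto
  have "\<exists>A U. open A \<and> k \<in> A \<and> open U \<and> 0 \<in> U \<and> (\<forall>a\<in>A. \<forall>u\<in>U. a - u \<notin> C)" if "k \<in> K" for k
  proof -
    have "open ((\<lambda>p. fst p - snd p) -` (- C))"
      using C by (intro open_vimage continuous_intros) auto
    moreover have "(k, 0) \<in> (\<lambda>p. fst p - snd p) -` (- C)" using C that by auto
    ultimately obtain A U where "open A" "open U" "(k, 0) \<in> A \<times> U" "A \<times> U \<subseteq> (\<lambda>p. fst p - snd p) -` (- C)"
      by (rule open_prod_elim)
    then show ?thesis by (intro exI[of _ A] exI[of _ U]) auto
  qed
  then obtain A U where AU: "\<And>k. k \<in> K \<Longrightarrow> open (A k) \<and> k \<in> A k \<and> open (U k) \<and> 0 \<in> U k \<and>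
      (\<forall>a\<in>A k. \<forall>u\<in>U k. a - u \<notin> C)"
    by metis
  obtain F where F: "F \<subseteq> K" "finite F" "K \<subseteq> (\<Union>k\<in>F. A k)"
    using compactE_image[OF assms, of K A] AU by blast
  define U' where "U' = (\<Inter>k\<in>F. U k)"
  have "open U'" unfolding U'_def using F AU by (intro open_INT) auto
  moreover have "0 \<in> U'" unfolding U'_def using F AU by auto
  moreover have "cf_nbhd K U' C \<subseteq> {C. closed C \<and> C \<inter> K = {}}"
  proof
    fix C' assume "C' \<in> cf_nbhd K U' C"
    then have C': "closed C'" "C' \<inter> K \<subseteq> set_prod C U'" by (auto simp: cf_nbhd_def)
    have False if x: "x \<in> C'" "x \<in> K" for x
    proof -
      obtain c u where cu: "c \<in> C" "u \<in> U'" "x = c + u" using C' x unfolding set_prod_def by blast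
      obtain k where k: "k \<in> F" "x \<in> A k" using F x by blast
      then have "u \<in> U k" "k \<in> K" using F cu by (auto simp: U'_def)
      then have "x - u \<notin> C" using AU k by blast
      then show False using cu by simp
    qed
    then show "C' \<in> {C. closed C \<and> C \<inter> K = {}}" using C' by blast
  qed
  ultimately show "\<exists>L U. compact L \<and> open U \<and> 0 \<in> U \<and> cf_nbhd L U C \<subseteq> {C. closed C \<and> C \<inter> K = {}}"
    using assms by (intro exI[of _ K] exI[of _ U']) auto
qed auto

text \<open>\<open>U\<close> enters by multiplication on the right, which commutes with left
  translation; so only the compact set moves.\<close>

lemma cf_nbhd_left_translate:
  "cf_nbhd K U (left_translate g C) = left_translate g ` cf_nbhd (left_translate (- g) K) U C"
  for g :: "'g::topological_group_add"
proof -
  have *: "left_translate g C' \<in> cf_nbhd K U (left_translate g C) \<longleftrightarrow>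
      C' \<in> cf_nbhd (left_translate (- g) K) U C" for C'
  proof -
    have "closed (left_translate g C') \<longleftrightarrow> closed C'"
      by (metis closed_left_translate left_translate_inverse(1))
    moreover have "left_translate g A \<inter> K \<subseteq> left_translate g B \<longleftrightarrow> A \<inter> left_translate (- g) K \<subseteq> B" for A B
      by (metis left_translate_Int left_translate_inverse(2) left_translate_subset_iff)
    ultimately show ?thesis
      by (simp add: cf_nbhd_def set_prod_left_translate)
  qed
  show ?thesis
  proof (intro equalityI subsetI)
    fix C' assume "C' \<in> cf_nbhd K U (left_translate g C)"
    then show "C' \<in> left_translate g ` cf_nbhd (left_translate (- g) K) U C"
      using * by (metis image_eqI left_translate_inverse(2))
  qed (use * in auto)
qed

lemma openin_chabauty_fell_left_translate:
  fixes W :: "'g::topological_group_add set set"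
  assumes "openin chabauty_fell W"
  shows "openin chabauty_fell (left_translate g ` W)"
  unfolding openin_chabauty_fell
proof (intro conjI ballI)
  show "left_translate g ` W \<subseteq> {C. closed C}"
    using assms closed_left_translate unfolding openin_chabauty_fell by blast
next
  fix D assume "D \<in> left_translate g ` W"
  then obtain C where C: "C \<in> W" "D = left_translate g C" by blast
  then obtain K U where KU: "compact K" "open U" "0 \<in> U" "cf_nbhd K U C \<subseteq> W"
    using assms unfolding openin_chabauty_fell by blast
  then show "\<exists>K U. compact K \<and> open U \<and> 0 \<in> U \<and> cf_nbhd K U D \<subseteq> left_translate g ` W"
    using C by (intro exI[of _ "left_translate g K"] exI[of _ U])
      (auto simp: cf_nbhd_left_translate compact_left_translate)
qed

lemma homeomorphic_map_left_translate:
  "homeomorphic_map chabauty_fell chabauty_fell (left_translate g)"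
  for g :: "'g::topological_group_add"
proof -
  have img: "left_translate h ` W = {C. left_translate (- h) C \<in> W}" for h and W :: "'g set set"
    by (auto intro!: image_eqI[of _ _ "left_translate (- h) _"])
  have "continuous_map chabauty_fell chabauty_fell (left_translate h)" for h :: 'g
  proof -
    have "openin chabauty_fell {C. closed C \<and> left_translate h C \<in> W}"
      if "openin chabauty_fell W" for W
    proof -
      have "{C. closed C \<and> left_translate h C \<in> W} = left_translate (- h) ` W"
        unfolding img using that closed_left_translate[of "left_translate h _" "- h"]
        by (auto simp: openin_chabauty_fell)
      then show ?thesis using that openin_chabauty_fell_left_translate by metis
    qed
    then show ?thesis
      using closed_left_translate by (auto simp: continuous_map_def)
  qed
  then show ?thesis
    unfolding homeomorphic_map_maps homeomorphic_maps_def
    by (intro exI[of _ "left_translate (- g)"]) auto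
qed

text \<open>The orbit is mapped into itself and a homeomorphism commutes with closure. Closedness of
  \<open>\<Lambda>\<close> places the orbit inside the topspace.\<close>

lemma left_translate_mem_cf_hull:
  fixes \<Lambda> :: "'g::topological_group_add set"
  assumes "closed \<Lambda>" "\<Gamma> \<in> cf_hull \<Lambda>"
  shows "left_translate g \<Gamma> \<in> cf_hull \<Lambda>"
proof -
  have "left_translate g ` range (\<lambda>x. left_translate x \<Lambda>) \<subseteq> range (\<lambda>x. left_translate x \<Lambda>)"
    by (auto simp: left_translate_left_translate)
  then have "chabauty_fell closure_of (left_translate g ` range (\<lambda>x. left_translate x \<Lambda>)) \<subseteq> cf_hull \<Lambda>"
    unfolding cf_hull_def by (rule closure_of_mono)
  moreover have "chabauty_fell closure_of (left_translate g ` range (\<lambda>x. left_translate x \<Lambda>)) = left_translate g ` cf_hull \<Lambda>"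
    unfolding cf_hull_def
    using assms closed_left_translate
    by (intro homeomorphic_map_closure_of homeomorphic_map_left_translate) auto
  ultimately show ?thesis using assms by blast
qed

text \<open>Limits enter through this form: an open condition that holds for a hull element holds
  for some translate of \<open>\<Lambda>\<close>. No nets or convergent sequences of sets are
  needed.\<close>

lemma cf_hull_meets_orbit:
  assumes "\<Gamma> \<in> cf_hull \<Lambda>" "openin chabauty_fell W" "\<Gamma> \<in> W"
  obtains x where "left_translate x \<Lambda> \<in> W"
  using assms unfolding cf_hull_def in_closure_of by blast

lemma closed_cf_hull: "\<Gamma> \<in> cf_hull \<Lambda> \<Longrightarrow> closed \<Gamma>"
  for \<Lambda> :: "'g::topological_group_add set"
  unfolding cf_hull_def using closure_of_subset_topspace by fastforce

section \<open>Nonnegative sums over closed sets and their lower semicontinuity\<close>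

lemma nn_integral_count_space_eq_infsum:
  fixes \<phi> :: "'a \<Rightarrow> real"
  assumes "\<phi> summable_on C" "\<And>x. 0 \<le> \<phi> x"
  shows "(\<integral>\<^sup>+\<gamma>. \<phi> \<gamma> \<partial>count_space C) = ennreal (infsum \<phi> C)"
proof -
  have "Infinite_Set_Sum.abs_summable_on \<phi> C"
    unfolding abs_summable_equivalent[symmetric] using assms by simp
  then show ?thesis using assms by (simp add: nn_integral_conv_infsetsum infsetsum_infsum)
qed

text \<open>A summable family has its finite partial sums as supremum; otherwise these are unbounded
  and exceed \<open>a\<close>, which is finite because something lies strictly above it.\<close>

lemma less_nn_integral_count_space_finite_subset:
  fixes \<phi> :: "'a \<Rightarrow> real"
  assumes nonneg: "\<And>x. 0 \<le> \<phi> x" and a: "a < (\<integral>\<^sup>+\<gamma>. \<phi> \<gamma> \<partial>count_space C)"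
  obtains S where "finite S" "S \<subseteq> C" "a < ennreal (\<Sum>s\<in>S. \<phi> s)"
proof -
  have "\<exists>S. finite S \<and> S \<subseteq> C \<and> a < ennreal (\<Sum>s\<in>S. \<phi> s)"
  proof (cases "\<phi> summable_on C")
    case True
    then have "(\<integral>\<^sup>+\<gamma>. \<phi> \<gamma> \<partial>count_space C) = (SUP S\<in>{S. finite S \<and> S \<subseteq> C}. ennreal (\<Sum>s\<in>S. \<phi> s))"
      using nonneg by (simp add: nn_integral_count_space_eq_infsum infsum_nonneg_is_SUPREMUM_ennreal)
    then show ?thesis using a by (auto simp: less_SUP_iff)
  next
    case False
    then have "\<not> bdd_above (sum \<phi> ` {F. F \<subseteq> C \<and> finite F})"
      using nonneg nonneg_bdd_above_summable_on[of C \<phi>] by blast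
    then obtain S where "finite S" "S \<subseteq> C" "enn2real a < (\<Sum>s\<in>S. \<phi> s)"
      by (force simp: bdd_above_def not_le)
    moreover have "a < top" using a by (rule less_le_trans) simp
    ultimately show ?thesis by (metis ennreal_enn2real ennreal_lessI enn2real_nonneg le_less_trans)
  qed
  then show ?thesis using that by blast
qed

text \<open>A finite part of \<open>C\<close> already witnesses the strict inequality. Any closed
  set that hits small disjoint neighbourhoods of these points has a sum almost as large, and hitting
  is an open condition.\<close>

lemma openin_chabauty_fell_sum_greater:
  fixes \<phi> :: "'g::{topological_group_add,t2_space} \<Rightarrow> real"
  assumes nonneg: "\<And>x. 0 \<le> \<phi> x" and lsc: "\<And>b. open {x. b < \<phi> x}"
  shows "openin chabauty_fell {C. closed C \<and> a < (\<integral>\<^sup>+\<gamma>. \<phi> \<gamma> \<partial>count_space C)}"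
proof (subst openin_subopen, intro ballI)
  fix C assume "C \<in> {C. closed C \<and> a < (\<integral>\<^sup>+\<gamma>. \<phi> \<gamma> \<partial>count_space C)}"
  then have C: "closed C" "a < (\<integral>\<^sup>+\<gamma>. \<phi> \<gamma> \<partial>count_space C)" by auto
  obtain S where S: "finite S" "S \<subseteq> C" "a < ennreal (\<Sum>s\<in>S. \<phi> s)"
    using less_nn_integral_count_space_finite_subset[OF nonneg C(2)] by metis
  obtain r where r: "a = ennreal r" "0 \<le> r" using S by (cases a) auto
  \<comment> \<open>The slack is divided among one share more than there are points, so that a loss
    of \<open>\<delta>\<close> at each point leaves the sum strictly above \<open>r\<close>, also
    when \<open>S\<close> is empty.\<close>
  define \<delta> where "\<delta> = ((\<Sum>s\<in>S. \<phi> s) - r) / (real (card S) + 1)"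
  have lt: "r < (\<Sum>s\<in>S. \<phi> s)" using S r by (simp add: ennreal_less_iff)
  then have \<delta>: "0 < \<delta>" by (simp add: \<delta>_def)
  have "\<delta> * (card S + 1) = (\<Sum>s\<in>S. \<phi> s) - r"
    by (simp add: \<delta>_def add_nonneg_eq_0_iff add.commute[of 1])
  then have \<delta>2: "r < (\<Sum>s\<in>S. \<phi> s - \<delta>)"
    using \<delta> by (simp add: sum_subtractf algebra_simps)
  obtain V where V: "\<And>s. s \<in> S \<Longrightarrow> open (V s)" "\<And>s. s \<in> S \<Longrightarrow> s \<in> V s"
    "\<And>s t. s \<in> S \<Longrightarrow> t \<in> S \<Longrightarrow> s \<noteq> t \<Longrightarrow> V s \<inter> V t = {}"
    using finite_disjoint_open_nbhds[OF S(1)] by metis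
  define V' where "V' s = V s \<inter> {x. \<phi> s - \<delta> < \<phi> x}" for s
  define T where "T = {C. closed C} \<inter> (\<Inter>s\<in>S. {C. closed C \<and> C \<inter> V' s \<noteq> {}})"
  have "openin chabauty_fell T"
  proof (cases "S = {}")
    case True then show ?thesis using openin_topspace[of chabauty_fell] by (simp add: T_def)
  next
    case False
    then show ?thesis unfolding T_def V'_def
      using V lsc S openin_topspace[of "chabauty_fell :: 'g set topology"]
      by (intro openin_Int openin_INT2 openin_chabauty_fell_hit open_Int) auto
  qed
  moreover have "C \<in> T"
  proof -
    have "s \<in> V' s" if "s \<in> S" for s using V(2)[OF that] \<delta> by (simp add: V'_def)
    then show ?thesis using C S by (auto simp: T_def)
  qed
  moreover have "T \<subseteq> {C. closed C \<and> a < (\<integral>\<^sup>+\<gamma>. \<phi> \<gamma> \<partial>count_space C)}"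
  proof
    fix C' assume C': "C' \<in> T"
    then have "\<forall>s\<in>S. \<exists>c. c \<in> C' \<and> c \<in> V' s" by (auto simp: T_def)
    then obtain c where c: "\<And>s. s \<in> S \<Longrightarrow> c s \<in> C' \<and> c s \<in> V' s" by metis
    \<comment> \<open>Disjoint neighbourhoods force distinct representatives; otherwise one point of
      \<open>C'\<close> would be counted several times.\<close>
    have inj: "inj_on c S"
    proof (rule inj_onI, rule ccontr)
      fix s t assume st: "s \<in> S" "t \<in> S" "c s = c t" "s \<noteq> t"
      then have "c s \<in> V s \<inter> V t" using c[of s] c[of t] by (simp add: V'_def)
      then show False using V st by blast
    qed
    have "(\<Sum>s\<in>S. \<phi> s - \<delta>) \<le> (\<Sum>s\<in>S. \<phi> (c s))"
      using c by (intro sum_mono) (simp add: V'_def less_imp_le)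
    then have "r < (\<Sum>s\<in>S. \<phi> (c s))"
      using \<delta>2 by linarith
    then have "a < ennreal (\<Sum>s\<in>S. \<phi> (c s))" using r by (simp add: ennreal_lessI)
    also have "\<dots> = (\<Sum>x\<in>c ` S. ennreal (\<phi> x))"
      using inj nonneg by (simp add: sum.reindex sum_ennreal)
    also have "\<dots> = (\<integral>\<^sup>+\<gamma>. \<phi> \<gamma> * indicator (c ` S) \<gamma> \<partial>count_space C')"
      using c S by (subst nn_integral_count_space'[of "c ` S"]) (auto intro!: sum.cong)
    also have "\<dots> \<le> (\<integral>\<^sup>+\<gamma>. \<phi> \<gamma> \<partial>count_space C')"
      by (intro nn_integral_mono) (auto simp: indicator_def)
    finally show "C' \<in> {C. closed C \<and> a < (\<integral>\<^sup>+\<gamma>. \<phi> \<gamma> \<partial>count_space C)}"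
      using C' by (auto simp: T_def)
  qed
  ultimately show "\<exists>T. openin chabauty_fell T \<and> C \<in> T \<and> T \<subseteq> {C. closed C \<and> a < (\<integral>\<^sup>+\<gamma>. \<phi> \<gamma> \<partial>count_space C)}"
    by blast
qed

subsection \<open>Separated sets, hulls and the intensity measure\<close>

lemma separated_mono: "separated B \<Lambda> \<Longrightarrow> A \<subseteq> B \<Longrightarrow> separated A \<Lambda>"
  unfolding separated_def
proof (intro allI conjI)
  fix g assume *: "\<forall>g. finite (\<Lambda> \<inter> left_translate g B) \<and> card (\<Lambda> \<inter> left_translate g B) \<le> 1" "A \<subseteq> B"
  then have sub: "\<Lambda> \<inter> left_translate g A \<subseteq> \<Lambda> \<inter> left_translate g B"
    by (auto simp: left_translate_def)
  show "finite (\<Lambda> \<inter> left_translate g A)" using * sub finite_subset by blast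
  show "card (\<Lambda> \<inter> left_translate g A) \<le> 1" using * sub card_mono order_trans by blast
qed

lemma separated_left_translate:
  assumes "separated S \<Lambda>" shows "separated S (left_translate x \<Lambda>)"
proof -
  have "left_translate x \<Lambda> \<inter> left_translate g S = left_translate x (\<Lambda> \<inter> left_translate (- x + g) S)" for g
    by (simp add: left_translate_Int left_translate_left_translate)
  then show ?thesis
    using assms bij_betw_finite[OF bij_betw_left_translate] bij_betw_same_card[OF bij_betw_left_translate]
    unfolding separated_def by metis
qed

text \<open>Writing separation as an upper bound on sums lets it pass to the hull by
  semicontinuity.\<close>

lemma separated_iff_sum_le_1:
  "separated S \<Lambda> \<longleftrightarrow> (\<forall>g. (\<integral>\<^sup>+\<gamma>. indicator (left_translate g S) \<gamma> \<partial>count_space \<Lambda>) \<le> 1)"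
proof -
  have "(finite (\<Lambda> \<inter> T) \<and> card (\<Lambda> \<inter> T) \<le> 1) \<longleftrightarrow> (\<integral>\<^sup>+\<gamma>. indicator T \<gamma> \<partial>count_space \<Lambda>) \<le> 1" for T :: "'a set"
  proof -
    have "(\<integral>\<^sup>+\<gamma>. indicator T \<gamma> \<partial>count_space \<Lambda>) = (\<integral>\<^sup>+\<gamma>. indicator (\<Lambda> \<inter> T) \<gamma> \<partial>count_space \<Lambda>)"
      by (intro nn_integral_cong) (auto simp: indicator_def)
    also have "\<dots> = emeasure (count_space \<Lambda>) (\<Lambda> \<inter> T)" by (rule nn_integral_indicator) auto
    finally show ?thesis
      by (cases "finite (\<Lambda> \<inter> T)")
        (simp_all add: emeasure_count_space ennreal_of_nat_eq_real_of_nat top_unique)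
  qed
  then show ?thesis by (simp add: separated_def)
qed

text \<open>A point \<open>p\<close> outside has the neighbourhood \<open>p + W\<close>, which
  contains at most one point of \<open>\<Lambda>\<close>; removing it leaves an open set.\<close>

lemma closed_if_separated:
  fixes \<Lambda> :: "'g::{topological_group_add,t2_space} set"
  assumes "open W" "0 \<in> W" "separated W \<Lambda>"
  shows "closed \<Lambda>"
proof -
  have "open (- \<Lambda>)"
  proof (subst open_subopen, intro ballI)
    fix p assume p: "p \<in> - \<Lambda>"
    let ?F = "\<Lambda> \<inter> left_translate p W"
    have "finite ?F" using assms by (auto simp: separated_def)
    then have "open (left_translate p W - ?F)"
      using assms by (intro open_Diff open_left_translate finite_imp_closed) auto
    then show "\<exists>T. open T \<and> p \<in> T \<and> T \<subseteq> - \<Lambda>"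
      using p assms by (intro exI[of _ "left_translate p W - ?F"]) (auto simp: mem_left_translate)
  qed
  then show ?thesis by (simp add: closed_def)
qed

lemma finite_Int_compact_if_separated:
  fixes \<Lambda> :: "'g::topological_group_add set"
  assumes "open W" "0 \<in> W" "separated W \<Lambda>" "compact K"
  shows "finite (\<Lambda> \<inter> K)"
proof -
  obtain F where F: "F \<subseteq> K" "finite F" "K \<subseteq> (\<Union>k\<in>F. left_translate k W)"
  proof (rule compactE_image[OF assms(4)])
    show "open (left_translate k W)" for k using assms open_left_translate by blast
    show "K \<subseteq> (\<Union>k\<in>K. left_translate k W)" using assms by (auto simp: mem_left_translate)
  qed
  have "\<Lambda> \<inter> K \<subseteq> (\<Union>k\<in>F. \<Lambda> \<inter> left_translate k W)" using F by blast
  moreover have "finite (\<Union>k\<in>F. \<Lambda> \<inter> left_translate k W)"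
    using F assms unfolding separated_def by (intro finite_UN_I) blast+
  ultimately show ?thesis by (rule finite_subset)
qed

lemma countable_translate_cover:
  fixes V :: "'g::{topological_group_add,second_countable_topology} set"
  assumes "open V" "0 \<in> V"
  obtains g :: "nat \<Rightarrow> 'g" where "(\<Union>n. left_translate (g n) V) = UNIV"
proof -
  obtain \<F> where "\<F> \<subseteq> range (\<lambda>g. left_translate g V)" "countable \<F>"
    "\<Union>\<F> = (\<Union>g. left_translate g V)"
    using assms open_left_translate by (rule_tac Lindelof[of "range (\<lambda>g. left_translate g V)"]) auto
  moreover from this obtain I where "countable I" "\<F> = (\<lambda>g. left_translate g V) ` I"
    using countable_subset_image[of \<F> "\<lambda>g. left_translate g V" UNIV] by blast
  ultimately have I: "countable I" "(\<Union>g\<in>I. left_translate g V) = (\<Union>g. left_translate g V)"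
    by simp_all
  have "x \<in> left_translate x V" for x using assms by (simp add: mem_left_translate)
  then have U: "(\<Union>g\<in>I. left_translate g V) = UNIV" using I by blast
  then have "I \<noteq> {}" by auto
  then have "(\<Union>g\<in>range (from_nat_into I). left_translate g V) = UNIV"
    using U I(1) by (subst range_from_nat_into)
  then show ?thesis by (intro that) (simp only: image_image)
qed

lemma countable_if_separated:
  fixes \<Lambda> :: "'g::{topological_group_add,second_countable_topology} set"
  assumes "open W" "0 \<in> W" "separated W \<Lambda>"
  shows "countable \<Lambda>"
proof -
  obtain g :: "nat \<Rightarrow> 'g" where g: "(\<Union>n. left_translate (g n) W) = UNIV"
    using countable_translate_cover[OF assms(1,2)] .
  have "countable (\<Union>n. \<Lambda> \<inter> left_translate (g n) W)"
    using assms by (intro countable_UN) (auto simp: separated_def intro: countable_finite)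
  also have "(\<Union>n. \<Lambda> \<inter> left_translate (g n) W) = \<Lambda>" using g by blast
  finally show ?thesis .
qed

text \<open>A sum above \<open>a\<close> is an open condition, so some translate of
  \<open>\<Lambda>\<close> would violate the bound too.\<close>

lemma cf_hull_sum_le:
  fixes \<phi> :: "'g::{topological_group_add,t2_space} \<Rightarrow> real"
  assumes "\<And>x. 0 \<le> \<phi> x" "\<And>b. open {x. b < \<phi> x}" "\<Gamma> \<in> cf_hull \<Lambda>"
    and le: "\<And>x. (\<integral>\<^sup>+\<gamma>. \<phi> \<gamma> \<partial>count_space (left_translate x \<Lambda>)) \<le> a"
  shows "(\<integral>\<^sup>+\<gamma>. \<phi> \<gamma> \<partial>count_space \<Gamma>) \<le> a"
proof (rule ccontr)
  assume "\<not> ?thesis"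
  then have "\<Gamma> \<in> {C. closed C \<and> a < (\<integral>\<^sup>+\<gamma>. \<phi> \<gamma> \<partial>count_space C)}"
    using closed_cf_hull assms by auto
  then show False
    using cf_hull_meets_orbit[OF assms(3) openin_chabauty_fell_sum_greater[OF assms(1,2), of a]] le
    by (metis (mono_tags, lifting) mem_Collect_eq not_less)
qed

lemma open_less_indicator: "open V \<Longrightarrow> open {x. (b::real) < indicator V x}"
  by (cases "b < 0"; cases "b < 1") (auto simp: indicator_def if_distrib cong: if_cong)

lemma separated_cf_hull:
  fixes \<Lambda> :: "'g::{topological_group_add,t2_space} set"
  assumes "open W" "separated W \<Lambda>" "\<Gamma> \<in> cf_hull \<Lambda>"
  shows "separated W \<Gamma>"
  unfolding separated_iff_sum_le_1
proof
  fix g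
  have "(\<integral>\<^sup>+\<gamma>. ennreal (indicator (left_translate g W) \<gamma>) \<partial>count_space \<Gamma>) \<le> 1"
  proof (rule cf_hull_sum_le[OF _ _ assms(3)])
    show "open {x. b < (indicator (left_translate g W) x :: real)}" for b
      by (intro open_less_indicator open_left_translate assms)
    show "(\<integral>\<^sup>+\<gamma>. ennreal (indicator (left_translate g W) \<gamma>) \<partial>count_space (left_translate x \<Lambda>)) \<le> 1" for x
      using separated_left_translate[OF assms(2)] separated_iff_sum_le_1 by (simp add: ennreal_indicator) blast
  qed auto
  then show "(\<integral>\<^sup>+\<gamma>. indicator (left_translate g W) \<gamma> \<partial>count_space \<Gamma>) \<le> 1"
    by (simp add: ennreal_indicator)
qed

text \<open>The empty set misses \<open>K\<close>, an open condition, but density makes every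
  translate of \<open>\<Lambda>\<close> meet \<open>K\<close>. This is what keeps the covolume
  finite.\<close>

lemma empty_notin_cf_hull:
  assumes "compact K" "dense_in K \<Lambda>" shows "{} \<notin> cf_hull \<Lambda>"
proof
  assume "{} \<in> cf_hull \<Lambda>"
  then obtain x where "left_translate x \<Lambda> \<in> {C. closed C \<and> C \<inter> K = {}}"
    by (rule cf_hull_meets_orbit[OF _ openin_chabauty_fell_miss[OF assms(1)]]) auto
  then have "left_translate x (\<Lambda> \<inter> left_translate (- x) K) = {}" by (simp add: left_translate_Int)
  then have "\<Lambda> \<inter> left_translate (- x) K = {}" by (simp add: left_translate_def)
  then show False using assms by (auto simp: dense_in_def)
qed

lemma nn_integral_count_space_left_translate:
  "(\<integral>\<^sup>+\<gamma>. f \<gamma> \<partial>count_space (left_translate g S)) = (\<integral>\<^sup>+\<gamma>. f (g + \<gamma>) \<partial>count_space S)"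
  for g :: "'g::group_add"
  by (rule nn_integral_bij_count_space[OF bij_betw_left_translate, symmetric])

locale separated_hull =
  fixes \<Lambda> W :: "'g::{topological_group_add,second_countable_topology,t2_space} set"
    and \<nu> :: "'g set measure"
  assumes open_W: "open W" and zero_in_W: "0 \<in> W" and separated_W: "separated W \<Lambda>"
    and invariant: "invariant_prob_on_hull \<Lambda> \<nu>"
begin

lemma space_hull: "space \<nu> = cf_hull \<Lambda>"
  and sets_hull: "sets \<nu> = sigma_sets (cf_hull \<Lambda>) {S. openin (subtopology chabauty_fell (cf_hull \<Lambda>)) S}"
  and emeasure_space_hull: "emeasure \<nu> (space \<nu>) = 1"
  and emeasure_translate: "B \<in> sets \<nu> \<Longrightarrow> emeasure \<nu> (left_translate g ` B) = emeasure \<nu> B"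
  using invariant by (auto simp: invariant_prob_on_hull_def)

lemma closed_Lambda: "closed \<Lambda>"
  using open_W zero_in_W separated_W by (rule closed_if_separated)

lemma separated_hull: "\<Gamma> \<in> space \<nu> \<Longrightarrow> separated W \<Gamma>"
  using separated_cf_hull[OF open_W separated_W] by (simp add: space_hull)

lemma sets_hull_open: "openin chabauty_fell S \<Longrightarrow> cf_hull \<Lambda> \<inter> S \<in> sets \<nu>"
  unfolding sets_hull by (intro sigma_sets.Basic) (auto simp: openin_subtopology)

lemma measurable_left_translate [measurable]: "left_translate g \<in> measurable \<nu> \<nu>"
proof (rule measurable_sigma_sets[OF sets_hull])
  show "{S. openin (subtopology chabauty_fell (cf_hull \<Lambda>)) S} \<subseteq> Pow (cf_hull \<Lambda>)"
    by (auto simp: openin_subtopology)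
  show "left_translate g \<in> space \<nu> \<rightarrow> cf_hull \<Lambda>"
    using left_translate_mem_cf_hull[OF closed_Lambda] by (auto simp: space_hull)
  fix S assume "S \<in> {S. openin (subtopology chabauty_fell (cf_hull \<Lambda>)) S}"
  then obtain T where T: "openin chabauty_fell T" "S = T \<inter> cf_hull \<Lambda>" by (auto simp: openin_subtopology)
  have "left_translate g -` S \<inter> space \<nu> = cf_hull \<Lambda> \<inter> left_translate (- g) ` T"
  proof (intro equalityI subsetI)
    fix C assume "C \<in> left_translate g -` S \<inter> space \<nu>"
    then show "C \<in> cf_hull \<Lambda> \<inter> left_translate (- g) ` T"
      using T space_hull by (auto intro!: image_eqI[of _ _ "left_translate g C"])
  next
    fix C assume "C \<in> cf_hull \<Lambda> \<inter> left_translate (- g) ` T"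
    then show "C \<in> left_translate g -` S \<inter> space \<nu>"
      using T space_hull left_translate_mem_cf_hull[OF closed_Lambda] by auto
  qed
  then show "left_translate g -` S \<inter> space \<nu> \<in> sets \<nu>"
    using sets_hull_open openin_chabauty_fell_left_translate T by metis
qed

lemma distr_left_translate: "distr \<nu> \<nu> (left_translate g) = \<nu>"
proof (rule measure_eqI)
  fix B assume B: "B \<in> sets (distr \<nu> \<nu> (left_translate g))"
  then have B': "B \<in> sets \<nu>" by simp
  have "left_translate g -` B \<inter> space \<nu> = left_translate (- g) ` B"
    using sets.sets_into_space[OF B'] left_translate_mem_cf_hull[OF closed_Lambda]
    by (auto simp: space_hull intro!: image_eqI[of _ _ "left_translate g _"])
  then show "emeasure (distr \<nu> \<nu> (left_translate g)) B = emeasure \<nu> B"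
    using B' by (simp add: emeasure_distr emeasure_translate)
qed simp

lemma nn_integral_hull_left_translate:
  "F \<in> borel_measurable \<nu> \<Longrightarrow> (\<integral>\<^sup>+\<Gamma>. F (left_translate g \<Gamma>) \<partial>\<nu>) = (\<integral>\<^sup>+\<Gamma>. F \<Gamma> \<partial>\<nu>)"
  by (metis distr_left_translate measurable_left_translate nn_integral_distr)

text \<open>By semicontinuity the sets where the count exceeds a level are relatively open in the
  hull.\<close>

lemma measurable_hull_count_open:
  assumes "open V"
  shows "(\<lambda>\<Gamma>. \<integral>\<^sup>+\<gamma>. indicator V \<gamma> \<partial>count_space \<Gamma>) \<in> borel_measurable \<nu>"
proof (rule borel_measurableI_greater)
  fix a :: ennreal
  have "{\<Gamma> \<in> space \<nu>. a < (\<integral>\<^sup>+\<gamma>. indicator V \<gamma> \<partial>count_space \<Gamma>)} =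
    cf_hull \<Lambda> \<inter> {C. closed C \<and> a < (\<integral>\<^sup>+\<gamma>. ennreal (indicator V \<gamma>) \<partial>count_space C)}"
    using closed_cf_hull by (auto simp: space_hull ennreal_indicator)
  also have "\<dots> \<in> sets \<nu>"
    using assms by (intro sets_hull_open openin_chabauty_fell_sum_greater open_less_indicator) auto
  finally show "{\<Gamma> \<in> space \<nu>. a < (\<integral>\<^sup>+\<gamma>. indicator V \<gamma> \<partial>count_space \<Gamma>)} \<in> sets \<nu>" .
qed

text \<open>An induction over Borel sets from the open ones. The complement step subtracts counts,
  which needs them to be finite; cutting with a translate of \<open>W\<close> bounds them by
  one.\<close>

lemma measurable_hull_count_Int_translate:
  assumes "B \<in> sets borel"
  shows "(\<lambda>\<Gamma>. \<integral>\<^sup>+\<gamma>. indicator (B \<inter> left_translate g W) \<gamma> \<partial>count_space \<Gamma>) \<in> borel_measurable \<nu>"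
proof -
  let ?V = "left_translate g W"
  let ?G = "{S :: 'g set. open S}"
  have V: "open ?V" by (intro open_left_translate open_W)
  have "Int_stable ?G" by (auto simp: Int_stable_def)
  moreover have "?G \<subseteq> Pow UNIV" by simp
  moreover have "B \<in> sigma_sets UNIV ?G" using assms by (simp add: borel_def)
  ultimately show ?thesis
  proof (induction rule: sigma_sets_induct_disjoint)
    case (basic A)
    then show ?case using V by (intro measurable_hull_count_open open_Int) auto
  next
    case empty
    then show ?case by simp
  next
    case (compl A)
    have "(\<integral>\<^sup>+\<gamma>. indicator ((UNIV - A) \<inter> ?V) \<gamma> \<partial>count_space \<Gamma>) =
      (\<integral>\<^sup>+\<gamma>. indicator ?V \<gamma> \<partial>count_space \<Gamma>) - (\<integral>\<^sup>+\<gamma>. indicator (A \<inter> ?V) \<gamma> \<partial>count_space \<Gamma>)" if "\<Gamma> \<in> space \<nu>" for \<Gamma>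
    proof -
      have "(\<integral>\<^sup>+\<gamma>. indicator (A \<inter> ?V) \<gamma> \<partial>count_space \<Gamma>) \<le> (\<integral>\<^sup>+\<gamma>. indicator ?V \<gamma> \<partial>count_space \<Gamma>)"
        by (intro nn_integral_mono) (auto simp: indicator_def)
      also have "\<dots> \<le> 1" using separated_hull[OF that] by (simp add: separated_iff_sum_le_1)
      finally have "(\<integral>\<^sup>+\<gamma>. indicator (A \<inter> ?V) \<gamma> \<partial>count_space \<Gamma>) \<noteq> \<infinity>"
        by (auto simp: top_unique)
      then have "(\<integral>\<^sup>+\<gamma>. indicator ?V \<gamma> - indicator (A \<inter> ?V) \<gamma> \<partial>count_space \<Gamma>) =
        (\<integral>\<^sup>+\<gamma>. indicator ?V \<gamma> \<partial>count_space \<Gamma>) - (\<integral>\<^sup>+\<gamma>. indicator (A \<inter> ?V) \<gamma> \<partial>count_space \<Gamma>)"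
        by (intro nn_integral_diff) (auto intro!: AE_I2 simp: indicator_def)
      moreover have "(\<integral>\<^sup>+\<gamma>. indicator ((UNIV - A) \<inter> ?V) \<gamma> \<partial>count_space \<Gamma>) =
        (\<integral>\<^sup>+\<gamma>. indicator ?V \<gamma> - indicator (A \<inter> ?V) \<gamma> \<partial>count_space \<Gamma>)"
        by (intro nn_integral_cong) (auto simp: indicator_def)
      ultimately show ?thesis by simp
    qed
    then show ?case
      using compl measurable_hull_count_open[OF V]
      by (subst measurable_cong[where g = "\<lambda>\<Gamma>. (\<integral>\<^sup>+\<gamma>. indicator ?V \<gamma> \<partial>count_space \<Gamma>) -
        (\<integral>\<^sup>+\<gamma>. indicator (A \<inter> ?V) \<gamma> \<partial>count_space \<Gamma>)"]) auto
  next
    case (union A)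
    have "indicator (\<Union> (range A) \<inter> ?V) \<gamma> = (\<Sum>n. indicator (A n \<inter> ?V) \<gamma> :: ennreal)" for \<gamma>
      using union by (subst suminf_indicator) (auto simp: disjoint_family_on_def)
    then show ?case
      using union by (simp add: nn_integral_suminf)
  qed
qed

lemma measurable_hull_count:
  assumes "B \<in> sets borel"
  shows "(\<lambda>\<Gamma>. \<integral>\<^sup>+\<gamma>. indicator B \<gamma> \<partial>count_space \<Gamma>) \<in> borel_measurable \<nu>"
proof -
  obtain g :: "nat \<Rightarrow> 'g" where g: "(\<Union>n. left_translate (g n) W) = UNIV"
    using countable_translate_cover[OF open_W zero_in_W] .
  \<comment> \<open>Disjoint Borel pieces, each inside one translate of \<open>W\<close>, make the
    count on \<open>B\<close> a countable sum of the bounded counts already treated.\<close>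
  define D where "D = disjointed (\<lambda>n. left_translate (g n) W)"
  have "range D \<subseteq> sets borel"
    unfolding D_def 
    by (intro sets.range_disjointed_sets image_subsetI borel_open open_left_translate open_W)
  then have [measurable]: "D n \<in> sets borel" for n by blast
  have "(\<Union>n. D n) = UNIV" "disjoint_family D" "D n \<subseteq> left_translate (g n) W" for n
    using g disjointed_subset[of "\<lambda>n. left_translate (g n) W" n]
    by (simp_all add: D_def UN_disjointed_eq disjoint_family_disjointed)
  note D = this
  have "indicator B \<gamma> = (\<Sum>n. indicator ((B \<inter> D n) \<inter> left_translate (g n) W) \<gamma> :: ennreal)" for \<gamma>
  proof -
    have "(\<Sum>n. indicator ((B \<inter> D n) \<inter> left_translate (g n) W) \<gamma> :: ennreal) =
      indicator (\<Union>n. (B \<inter> D n) \<inter> left_translate (g n) W) \<gamma>"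
      using D by (intro suminf_indicator) (auto simp: disjoint_family_on_def)
    also have "(\<Union>n. (B \<inter> D n) \<inter> left_translate (g n) W) = B \<inter> (\<Union>n. D n)" using D(3) by blast
    finally show ?thesis using D(1) by simp
  qed
  then show ?thesis
    using assms measurable_hull_count_Int_translate by (simp add: nn_integral_suminf)
qed

lemma measurable_hull_sum:
  assumes "f \<in> borel_measurable borel"
  shows "(\<lambda>\<Gamma>. \<integral>\<^sup>+\<gamma>. f \<gamma> \<partial>count_space \<Gamma>) \<in> borel_measurable \<nu>"
  using assms
proof (induction rule: borel_measurable_induct)
  case (cong f g)
  then show ?case by (simp cong: nn_integral_cong)
next
  case (set A)
  then show ?case by (rule measurable_hull_count)
next
  case (mult u c)
  then show ?case by (simp add: nn_integral_cmult)
next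
  case (add u v)
  then show ?case by (simp add: nn_integral_add)
next
  case (seq U)
  have "(\<integral>\<^sup>+\<gamma>. (SUP i. U i) \<gamma> \<partial>count_space \<Gamma>) = (SUP i. \<integral>\<^sup>+\<gamma>. U i \<gamma> \<partial>count_space \<Gamma>)" for \<Gamma>
    using seq by (simp add: image_image nn_integral_monotone_convergence_SUP)
  then show ?case using seq by simp
qed

section \<open>The intensity measure of the random point set\<close>

definition intensity :: "'g measure" where
  "intensity = measure_of UNIV (sets borel) (\<lambda>B. \<integral>\<^sup>+\<Gamma>. \<integral>\<^sup>+\<gamma>. indicator B \<gamma> \<partial>count_space \<Gamma> \<partial>\<nu>)"

lemma sets_intensity [measurable_cong]: "sets intensity = sets borel"
  unfolding intensity_def
  by (metis sets.sets_measure_of_eq space_borel)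

lemma space_intensity [simp]: "space intensity = UNIV"
  using sets_eq_imp_space_eq[OF sets_intensity] by simp

lemma emeasure_intensity:
  assumes "B \<in> sets borel"
  shows "emeasure intensity B = (\<integral>\<^sup>+\<Gamma>. \<integral>\<^sup>+\<gamma>. indicator B \<gamma> \<partial>count_space \<Gamma> \<partial>\<nu>)"
proof (rule emeasure_measure_of[OF intensity_def])
  show "B \<in> sets intensity" using assms by (simp add: sets_intensity)
  show "countably_additive (sets intensity) (\<lambda>B. \<integral>\<^sup>+\<Gamma>. \<integral>\<^sup>+\<gamma>. indicator B \<gamma> \<partial>count_space \<Gamma> \<partial>\<nu>)"
  proof (rule countably_additiveI)
    fix A :: "nat \<Rightarrow> 'g set"
    assume A: "range A \<subseteq> sets intensity" "disjoint_family A" "\<Union> (range A) \<in> sets intensity"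
    have "(\<Sum>i. (\<integral>\<^sup>+\<Gamma>. \<integral>\<^sup>+\<gamma>. indicator (A i) \<gamma> \<partial>count_space \<Gamma> \<partial>\<nu>)) =
      (\<integral>\<^sup>+\<Gamma>. (\<Sum>i. (\<integral>\<^sup>+\<gamma>. indicator (A i) \<gamma> \<partial>count_space \<Gamma>)) \<partial>\<nu>)"
      using A by (intro nn_integral_suminf[symmetric] measurable_hull_count) (auto simp: sets_intensity)
    also have "\<dots> = (\<integral>\<^sup>+\<Gamma>. \<integral>\<^sup>+\<gamma>. (\<Sum>i. indicator (A i) \<gamma>) \<partial>count_space \<Gamma> \<partial>\<nu>)"
      by (simp add: nn_integral_suminf)
    finally show "(\<Sum>i. (\<integral>\<^sup>+\<Gamma>. \<integral>\<^sup>+\<gamma>. indicator (A i) \<gamma> \<partial>count_space \<Gamma> \<partial>\<nu>)) =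
      (\<integral>\<^sup>+\<Gamma>. \<integral>\<^sup>+\<gamma>. indicator (\<Union> (range A)) \<gamma> \<partial>count_space \<Gamma> \<partial>\<nu>)"
      using A by (simp add: suminf_indicator)
  qed
qed (auto simp: positive_def)

text \<open>Campbell's formula, obtained from indicators by linearity and monotone convergence on
  both sides.\<close>

lemma nn_integral_intensity:
  assumes "f \<in> borel_measurable borel"
  shows "(\<integral>\<^sup>+x. f x \<partial>intensity) = (\<integral>\<^sup>+\<Gamma>. \<integral>\<^sup>+\<gamma>. f \<gamma> \<partial>count_space \<Gamma> \<partial>\<nu>)"
  using assms
proof (induction rule: borel_measurable_induct)
  case (cong f g)
  then show ?case by (simp cong: nn_integral_cong)
next
  case (set A)
  then show ?case by (simp add: emeasure_intensity sets_intensity)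
next
  case (mult u c)
  then show ?case using measurable_hull_sum[of u] by (simp add: nn_integral_cmult)
next
  case (add u v)
  then show ?case using measurable_hull_sum[of u] measurable_hull_sum[of v]
    by (simp add: nn_integral_add)
next
  case (seq U)
  have m: "U i \<in> borel_measurable intensity" for i using seq by (auto cong: measurable_cong_sets simp: sets_intensity)
  have inc: "incseq (\<lambda>i \<Gamma>. \<integral>\<^sup>+\<gamma>. U i \<gamma> \<partial>count_space \<Gamma>)"
    using seq(3) by (auto simp: incseq_def le_fun_def intro!: nn_integral_mono)
  have "(\<integral>\<^sup>+x. (SUP i. U i) x \<partial>intensity) = (SUP i. \<integral>\<^sup>+x. U i x \<partial>intensity)"
    using seq m by (simp add: image_image nn_integral_monotone_convergence_SUP)
  also have "\<dots> = (SUP i. \<integral>\<^sup>+\<Gamma>. \<integral>\<^sup>+\<gamma>. U i \<gamma> \<partial>count_space \<Gamma> \<partial>\<nu>)" using seq by simp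
  also have "\<dots> = (\<integral>\<^sup>+\<Gamma>. (SUP i. \<integral>\<^sup>+\<gamma>. U i \<gamma> \<partial>count_space \<Gamma>) \<partial>\<nu>)"
    using seq measurable_hull_sum inc
    by (intro nn_integral_monotone_convergence_SUP[symmetric]) auto
  also have "\<dots> = (\<integral>\<^sup>+\<Gamma>. \<integral>\<^sup>+\<gamma>. (SUP i. U i) \<gamma> \<partial>count_space \<Gamma> \<partial>\<nu>)"
    using seq by (simp add: image_image nn_integral_monotone_convergence_SUP)
  finally show ?case .
qed

text \<open>Points of \<open>\<Gamma>\<close> in the translate of \<open>B\<close> by
  \<open>g\<close> correspond to points of the translate of \<open>\<Gamma>\<close> by
  \<open>- g\<close> in \<open>B\<close>, and \<open>\<nu>\<close> does not see this translation of
  \<open>\<Gamma>\<close>.\<close>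

lemma emeasure_intensity_translate:
  assumes "B \<in> sets borel"
  shows "emeasure intensity (left_translate g B) = emeasure intensity B"
proof -
  have "left_translate g B = (\<lambda>x. - g + x) -` B \<inter> space borel"
    by (auto simp: left_translate_eq_vimage)
  also have "\<dots> \<in> sets borel" by (rule measurable_sets[OF _ assms]) measurable
  finally have "left_translate g B \<in> sets borel" .
  then have "emeasure intensity (left_translate g B) =
      (\<integral>\<^sup>+\<Gamma>. \<integral>\<^sup>+\<gamma>. indicator (left_translate g B) \<gamma> \<partial>count_space \<Gamma> \<partial>\<nu>)"
    by (rule emeasure_intensity)
  also have "\<dots> = (\<integral>\<^sup>+\<Gamma>. \<integral>\<^sup>+\<gamma>. indicator B \<gamma> \<partial>count_space (left_translate (- g) \<Gamma>) \<partial>\<nu>)"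
    unfolding nn_integral_count_space_left_translate
    by (intro nn_integral_cong) (simp add: indicator_def mem_left_translate)
  also have "\<dots> = (\<integral>\<^sup>+\<Gamma>. \<integral>\<^sup>+\<gamma>. indicator B \<gamma> \<partial>count_space \<Gamma> \<partial>\<nu>)"
    by (intro nn_integral_hull_left_translate measurable_hull_count assms)
  also have "\<dots> = emeasure intensity B" by (rule emeasure_intensity[OF assms, symmetric])
  finally show ?thesis .
qed

text \<open>No hull element has more than one point in \<open>W\<close>, and \<open>\<nu>\<close>
  has total mass one. Sigma-finiteness of the intensity rests on this bound.\<close>

lemma emeasure_intensity_W: "emeasure intensity W \<le> 1"
proof -
  have "emeasure intensity W = (\<integral>\<^sup>+\<Gamma>. \<integral>\<^sup>+\<gamma>. indicator W \<gamma> \<partial>count_space \<Gamma> \<partial>\<nu>)"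
    using open_W by (intro emeasure_intensity) auto
  also have "\<dots> \<le> (\<integral>\<^sup>+\<Gamma>. 1 \<partial>\<nu>)"
  proof (intro nn_integral_mono)
    fix \<Gamma> assume "\<Gamma> \<in> space \<nu>"
    then have "\<forall>g. (\<integral>\<^sup>+\<gamma>. indicator (left_translate g W) \<gamma> \<partial>count_space \<Gamma>) \<le> 1"
      using separated_hull separated_iff_sum_le_1 by blast
    from this[rule_format, of 0] show "(\<integral>\<^sup>+\<gamma>. indicator W \<gamma> \<partial>count_space \<Gamma>) \<le> 1" by simp
  qed
  finally show ?thesis by (simp add: emeasure_space_hull)
qed

text \<open>If \<open>W\<close> were null, so would be its translates, and countably many of them
  cover the group. The mean total number of points would vanish, although every hull element has at
  least one.\<close>

lemma emeasure_intensity_W_pos: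
  assumes "{} \<notin> cf_hull \<Lambda>"
  shows "0 < emeasure intensity W"
proof (rule ccontr)
  assume "\<not> ?thesis"
  then have W0: "emeasure intensity W = 0" by (simp add: zero_less_iff_neq_zero)
  obtain g :: "nat \<Rightarrow> 'g" where g: "(\<Union>n. left_translate (g n) W) = UNIV"
    using countable_translate_cover[OF open_W zero_in_W] .
  have "emeasure intensity (\<Union>n. left_translate (g n) W) = 0"
    using open_left_translate[OF open_W] W0 open_W
    by (intro emeasure_UN_eq_0) (auto simp: sets_intensity emeasure_intensity_translate)
  then have "(\<integral>\<^sup>+\<Gamma>. \<integral>\<^sup>+\<gamma>. indicator UNIV \<gamma> \<partial>count_space \<Gamma> \<partial>\<nu>) = 0"
    using g emeasure_intensity[of UNIV] by simp
  moreover have "1 \<le> (\<integral>\<^sup>+\<gamma>. indicator UNIV \<gamma> \<partial>count_space \<Gamma>)" if \<Gamma>: "\<Gamma> \<in> space \<nu>" for \<Gamma>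
  proof -
    have "\<Gamma> \<noteq> {}" using \<Gamma> assms by (auto simp: space_hull)
    then obtain \<gamma>0 where \<gamma>0: "\<gamma>0 \<in> \<Gamma>" by auto
    have "1 = emeasure (count_space \<Gamma>) {\<gamma>0}" using \<gamma>0 by simp
    also have "\<dots> \<le> emeasure (count_space \<Gamma>) \<Gamma>" using \<gamma>0 by (intro emeasure_mono) auto
    finally show ?thesis by (simp add: indicator_def)
  qed
  then have "(\<integral>\<^sup>+\<Gamma>. 1 \<partial>\<nu>) \<le> (\<integral>\<^sup>+\<Gamma>. \<integral>\<^sup>+\<gamma>. indicator UNIV \<gamma> \<partial>count_space \<Gamma> \<partial>\<nu>)"
    by (intro nn_integral_mono) auto
  ultimately show False by (simp add: emeasure_space_hull)
qed

end

subsection \<open>Uniqueness of Haar measure and the covolume\<close>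

locale left_invariant_measure =
  fixes M :: "'g::{topological_group_add,second_countable_topology,t2_space} measure"
  assumes sets_eq_borel [measurable_cong, simp]: "sets M = sets borel"
    and emeasure_left_translate: "B \<in> sets borel \<Longrightarrow> emeasure M (left_translate g B) = emeasure M B"
begin

lemma space_eq_UNIV [simp]: "space M = UNIV"
  using sets_eq_imp_space_eq[OF sets_eq_borel] by simp

lemma distr_add_left: "distr M M ((+) g) = M"
proof (rule measure_eqI)
  fix B assume "B \<in> sets (distr M M ((+) g))"
  then have B: "B \<in> sets borel" by simp
  have "(+) g -` B \<inter> space M = left_translate (- g) B"
    by (auto simp: left_translate_eq_vimage)
  then show "emeasure (distr M M ((+) g)) B = emeasure M B"
    using B by (simp add: emeasure_distr emeasure_left_translate)
qed simp

lemma nn_integral_add_left: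
  assumes "f \<in> borel_measurable borel"
  shows "(\<integral>\<^sup>+x. f (g + x) \<partial>M) = (\<integral>\<^sup>+x. f x \<partial>M)"
proof -
  have "(\<integral>\<^sup>+x. f x \<partial>distr M M ((+) g)) = (\<integral>\<^sup>+x. f (g + x) \<partial>M)"
    using assms by (intro nn_integral_distr) auto
  then show ?thesis by (simp add: distr_add_left)
qed

lemma integral_add_left:
  fixes f :: "'g \<Rightarrow> real"
  assumes "f \<in> borel_measurable borel"
  shows "(\<integral>x. f (g + x) \<partial>M) = (\<integral>x. f x \<partial>M)"
proof -
  have "(\<integral>x. f x \<partial>distr M M ((+) g)) = (\<integral>x. f (g + x) \<partial>M)"
    using assms by (intro integral_distr) auto
  then show ?thesis by (simp add: distr_add_left)
qed

lemma sigma_finite: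
  assumes "open V" "0 \<in> V" "emeasure M V < \<infinity>"
  shows "sigma_finite_measure M"
proof
  obtain g :: "nat \<Rightarrow> 'g" where g: "(\<Union>n. left_translate (g n) V) = UNIV"
    using countable_translate_cover[OF assms(1,2)] .
  show "\<exists>A. countable A \<and> A \<subseteq> sets M \<and> \<Union>A = space M \<and> (\<forall>a\<in>A. emeasure M a \<noteq> \<infinity>)"
    using g assms borel_open[OF open_left_translate]
    by (intro exI[of _ "range (\<lambda>n. left_translate (g n) V)"]) (auto simp: emeasure_left_translate)
qed

end

text \<open>Weil's substitution: shift \<open>x\<close> by \<open>- y\<close> under \<open>M\<close>, then \<open>y\<close> by \<open>x\<close> under \<open>N\<close>. The right-hand
  side depends on \<open>M\<close> only through the integral of \<open>G\<close>, which forces any two left-invariant measures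
  to be proportional.\<close>

lemma nn_integral_left_invariant_swap:
  assumes "left_invariant_measure M" "left_invariant_measure N"
    and "sigma_finite_measure M" "sigma_finite_measure N"
    and [measurable]: "F \<in> borel_measurable borel" "G \<in> borel_measurable borel"
  shows "(\<integral>\<^sup>+x. F x * (\<integral>\<^sup>+y. G (y + x) \<partial>N) \<partial>M) = (\<integral>\<^sup>+x. G x \<partial>M) * (\<integral>\<^sup>+y. F (- y) \<partial>N)"
proof -
  interpret M: left_invariant_measure M by fact
  interpret N: left_invariant_measure N by fact
  interpret MN: pair_sigma_finite M N using assms by (simp add: pair_sigma_finite_def)
  have "(\<integral>\<^sup>+x. F x * (\<integral>\<^sup>+y. G (y + x) \<partial>N) \<partial>M) = (\<integral>\<^sup>+x. \<integral>\<^sup>+y. F x * G (y + x) \<partial>N \<partial>M)"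
    by (intro nn_integral_cong nn_integral_cmult[symmetric]) measurable
  also have "\<dots> = (\<integral>\<^sup>+y. \<integral>\<^sup>+x. F x * G (y + x) \<partial>M \<partial>N)"
    by (intro MN.Fubini'[symmetric]) measurable
  also have "\<dots> = (\<integral>\<^sup>+y. \<integral>\<^sup>+x. F (- y + x) * G x \<partial>M \<partial>N)"
  proof (rule nn_integral_cong)
    fix y
    show "(\<integral>\<^sup>+x. F x * G (y + x) \<partial>M) = (\<integral>\<^sup>+x. F (- y + x) * G x \<partial>M)"
      using M.nn_integral_add_left[of "\<lambda>x. F x * G (y + x)" "- y"] by (simp add: add.assoc[symmetric])
  qed
  also have "\<dots> = (\<integral>\<^sup>+x. \<integral>\<^sup>+y. F (- y + x) * G x \<partial>N \<partial>M)"
    by (intro MN.Fubini') measurable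
  also have "\<dots> = (\<integral>\<^sup>+x. \<integral>\<^sup>+y. F (- y) * G x \<partial>N \<partial>M)"
  proof (rule nn_integral_cong)
    fix x
    show "(\<integral>\<^sup>+y. F (- y + x) * G x \<partial>N) = (\<integral>\<^sup>+y. F (- y) * G x \<partial>N)"
      using N.nn_integral_add_left[of "\<lambda>y. F (- y + x) * G x" "x"]
      by (simp add: minus_add add.assoc)
  qed
  also have "\<dots> = (\<integral>\<^sup>+x. G x * (\<integral>\<^sup>+y. F (- y) \<partial>N) \<partial>M)"
  proof (rule nn_integral_cong)
    fix x
    show "(\<integral>\<^sup>+y. F (- y) * G x \<partial>N) = G x * (\<integral>\<^sup>+y. F (- y) \<partial>N)"
      by (subst nn_integral_multc) (auto simp: mult.commute)
  qed
  also have "\<dots> = (\<integral>\<^sup>+x. G x \<partial>M) * (\<integral>\<^sup>+y. F (- y) \<partial>N)"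
    by (intro nn_integral_multc) measurable
  finally show ?thesis .
qed

text \<open>The swap formula writes the integral of \<open>f\<close> under \<open>L\<close> as
  \<open>emeasure L V\<close> times a factor built from \<open>f\<close>, \<open>V\<close> and
  \<open>N\<close> alone. Taking \<open>L = M\<close> and \<open>L = N\<close> and multiplying
  crosswise eliminates this factor.\<close>

lemma left_invariant_measure_unique:
  assumes M: "left_invariant_measure M" "sigma_finite_measure M"
    and N: "left_invariant_measure N" "sigma_finite_measure N"
    and V: "V \<in> sets borel" "\<And>x. 0 < emeasure N {t. t + x \<in> V}" "\<And>x. emeasure N {t. t + x \<in> V} < \<infinity>"
    and f[measurable]: "f \<in> borel_measurable borel"
  shows "(\<integral>\<^sup>+x. f x \<partial>M) * emeasure N V = (\<integral>\<^sup>+x. f x \<partial>N) * emeasure M V"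
proof -
  interpret N: left_invariant_measure N by fact
  interpret sN: sigma_finite_measure N by fact
  note V(1)[measurable]
  \<comment> \<open>\<open>w x\<close> is the \<open>N\<close>-measure of a right translate of
    \<open>V\<close>, and may vary with \<open>x\<close>. Being positive and finite, it can be
    divided out, so the swap formula applies with \<open>F = f / w\<close> and
    \<open>G = indicator V\<close>.\<close>
  define w where "w x = (\<integral>\<^sup>+t. indicator V (t + x) \<partial>N)" for x
  have w_meas[measurable]: "w \<in> borel_measurable borel"
    unfolding w_def by measurable
  have "w x = emeasure N {t. t + x \<in> V}" for x
  proof -
    have "w x = (\<integral>\<^sup>+t. indicator {t. t + x \<in> V} t \<partial>N)"
      unfolding w_def by (intro nn_integral_cong) (auto simp: indicator_def)
    also have "\<dots> = emeasure N {t. t + x \<in> V}"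
      by (intro nn_integral_indicator) (simp add: pred_def)
    finally show ?thesis .
  qed
  then have w: "0 < w x" "w x < \<infinity>" for x using V by auto
  have "(\<integral>\<^sup>+x. f x \<partial>L) = emeasure L V * (\<integral>\<^sup>+y. f (- y) / w (- y) \<partial>N)"
    if L: "left_invariant_measure L" "sigma_finite_measure L" for L
  proof -
    interpret L: left_invariant_measure L by fact
    have "f x = f x / w x * w x" for x
      using w[of x] by (simp add: ennreal_divide_times)
    then have "(\<integral>\<^sup>+x. f x \<partial>L) = (\<integral>\<^sup>+x. f x / w x * (\<integral>\<^sup>+t. indicator V (t + x) \<partial>N) \<partial>L)"
      unfolding w_def[symmetric] by simp
    also have "\<dots> = (\<integral>\<^sup>+x. indicator V x \<partial>L) * (\<integral>\<^sup>+y. f (- y) / w (- y) \<partial>N)"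
      by (rule nn_integral_left_invariant_swap[OF L(1) N(1) L(2) N(2)]) measurable
    finally show ?thesis using V by simp
  qed
  from this[OF M] this[OF N] show ?thesis by (simp add: mult_ac)
qed

text \<open>Summability is not assumed: when it fails, both sums take the default value 0.\<close>

lemma infsum_complex_of_real:
  "infsum (\<lambda>x. complex_of_real (u x)) A = complex_of_real (infsum u A)"
proof (cases "u summable_on A")
  case True
  then show ?thesis by (intro infsumI has_sum_of_real has_sum_infsum)
next
  case False
  then have "\<not> (\<lambda>x. complex_of_real (u x)) summable_on A"
    using summable_on_Re[of "\<lambda>x. complex_of_real (u x)" A] by auto
  then show ?thesis using False by (simp add: infsum_not_exists)
qed

section \<open>The covolume as proportionality constant\<close>

locale haar_hull = separated_hull +
  fixes \<mu> :: "'a measure" and Q K :: "'a set"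
  assumes haar: "left_haar_measure \<mu>"
    and compact_Q: "compact Q" and W_subset_Q: "W \<subseteq> Q"
    and compact_K: "compact K" and dense_K: "dense_in K \<Lambda>"
begin

sublocale \<mu>: left_invariant_measure \<mu>
  using haar by unfold_locales (auto simp: left_haar_measure_def)

sublocale intensity: left_invariant_measure intensity
  by unfold_locales (auto simp: sets_intensity emeasure_intensity_translate)

lemma emeasure_mu_compact: "compact C \<Longrightarrow> emeasure \<mu> C < \<infinity>"
  and emeasure_mu_open: "open U \<Longrightarrow> U \<noteq> {} \<Longrightarrow> 0 < emeasure \<mu> U"
  using haar by (auto simp: left_haar_measure_def)

lemma emeasure_mu_W: "0 < emeasure \<mu> W" "emeasure \<mu> W < \<infinity>"
proof -
  show "0 < emeasure \<mu> W" using open_W zero_in_W emeasure_mu_open by blast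
  have "emeasure \<mu> W \<le> emeasure \<mu> Q"
    using W_subset_Q compact_Q by (intro emeasure_mono) (auto intro: borel_closed compact_imp_closed)
  then show "emeasure \<mu> W < \<infinity>" using emeasure_mu_compact[OF compact_Q] by (rule le_less_trans)
qed

lemma sigma_finite_mu: "sigma_finite_measure \<mu>"
  using open_W zero_in_W emeasure_mu_W by (intro \<mu>.sigma_finite)

lemma sigma_finite_intensity: "sigma_finite_measure intensity"
  using open_W zero_in_W le_less_trans[OF emeasure_intensity_W] by (intro intensity.sigma_finite) auto

text \<open>The factor between Haar measure and intensity, read off at \<open>W\<close>, where both
  measures are positive and finite.\<close>

definition covolume :: real where
  "covolume = measure \<mu> W / measure intensity W"

lemma covolume_pos: "0 < covolume"
  and nn_integral_hull_sum: "f \<in> borel_measurable borel \<Longrightarrow>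
    (\<integral>\<^sup>+\<Gamma>. \<integral>\<^sup>+\<gamma>. f \<gamma> \<partial>count_space \<Gamma> \<partial>\<nu>) = ennreal (1 / covolume) * (\<integral>\<^sup>+x. f x \<partial>\<mu>)"
proof -
  have \<mu>W: "emeasure \<mu> W = ennreal (measure \<mu> W)" using emeasure_mu_W by (simp add: emeasure_eq_ennreal_measure)
  have iW: "emeasure intensity W = ennreal (measure intensity W)"
    using emeasure_intensity_W by (intro emeasure_eq_ennreal_measure) (auto simp: top_unique)
  have p\<mu>: "0 < measure \<mu> W" using \<mu>W emeasure_mu_W by simp
  have pi: "0 < measure intensity W"
    using iW emeasure_intensity_W_pos empty_notin_cf_hull[OF compact_K dense_K] by simp
  show "0 < covolume" unfolding covolume_def using p\<mu> pi by simp
  assume f: "f \<in> borel_measurable borel"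
  \<comment> \<open>Left invariance says nothing about these right translates of \<open>W\<close>.
    They are open and contain \<open>- x\<close>, hence have positive measure, and lie in the
    compact set of all \<open>q - x\<close> with \<open>q \<in> Q\<close>, hence have finite
    measure.\<close>
  have *: "0 < emeasure \<mu> {t. t + x \<in> W} \<and> emeasure \<mu> {t. t + x \<in> W} < \<infinity>" for x
  proof -
    have "open ((\<lambda>t. t + x) -` W)" using open_W by (intro open_vimage continuous_intros)
    moreover have "- x \<in> (\<lambda>t. t + x) -` W" using zero_in_W by simp
    ultimately have pos: "0 < emeasure \<mu> ((\<lambda>t. t + x) -` W)" by (intro emeasure_mu_open) blast+
    have C: "compact ((\<lambda>q. q - x) ` Q)"
      using compact_Q by (intro compact_continuous_image continuous_intros)
    have "t \<in> (\<lambda>q. q - x) ` Q" if "t + x \<in> W" for t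
      using that W_subset_Q by (intro image_eqI[of _ _ "t + x"]) auto
    then have "emeasure \<mu> ((\<lambda>t. t + x) -` W) \<le> emeasure \<mu> ((\<lambda>q. q - x) ` Q)"
      using C by (intro emeasure_mono) (auto intro: borel_closed compact_imp_closed)
    then have "emeasure \<mu> ((\<lambda>t. t + x) -` W) < \<infinity>"
      using emeasure_mu_compact[OF C] by (rule le_less_trans)
    then show ?thesis using pos by (simp add: vimage_def)
  qed
  have "(\<integral>\<^sup>+x. f x \<partial>intensity) * emeasure \<mu> W = (\<integral>\<^sup>+x. f x \<partial>\<mu>) * emeasure intensity W"
    using * open_W f sigma_finite_mu sigma_finite_intensity
    by (intro left_invariant_measure_unique) (auto intro: \<mu>.left_invariant_measure_axioms intensity.left_invariant_measure_axioms)
  then have "(\<integral>\<^sup>+x. f x \<partial>intensity) * (ennreal (measure \<mu> W) * ennreal (1 / measure \<mu> W)) =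
      (\<integral>\<^sup>+x. f x \<partial>\<mu>) * (ennreal (measure intensity W) * ennreal (1 / measure \<mu> W))"
    unfolding \<mu>W iW by (simp add: mult.assoc[symmetric])
  moreover have "ennreal (measure \<mu> W) * ennreal (1 / measure \<mu> W) = 1"
    using p\<mu> by (subst ennreal_mult[symmetric]) auto
  moreover have "ennreal (measure intensity W) * ennreal (1 / measure \<mu> W) = ennreal (1 / covolume)"
    using p\<mu> pi by (subst ennreal_mult[symmetric]) (auto simp: covolume_def)
  ultimately show "(\<integral>\<^sup>+\<Gamma>. \<integral>\<^sup>+\<gamma>. f \<gamma> \<partial>count_space \<Gamma> \<partial>\<nu>) = ennreal (1 / covolume) * (\<integral>\<^sup>+x. f x \<partial>\<mu>)"
    using f by (simp add: nn_integral_intensity mult.commute)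
qed

text \<open>Carries the extended nonnegative formula over to the real integrals and unordered sums
  in which \<open>covol\<close> is phrased. A hull element meets the compact set \<open>C\<close> in
  finitely many points, so its sum is finite.\<close>

lemma has_bochner_integral_hull_sum_nonneg:
  fixes u :: "'a \<Rightarrow> real"
  assumes u: "continuous_on UNIV u" "\<And>x. 0 \<le> u x" and C: "compact C" "\<And>x. x \<notin> C \<Longrightarrow> u x = 0"
  shows "has_bochner_integral \<mu> u (\<integral>x. u x \<partial>\<mu>)"
    and "has_bochner_integral \<nu> (\<lambda>\<Gamma>. infsum u \<Gamma>) (1 / covolume * (\<integral>x. u x \<partial>\<mu>))"
proof -
  have [measurable]: "u \<in> borel_measurable borel" using u by (intro borel_measurable_continuous_onI)
  have "bounded (u ` C)" using u C by (intro compact_imp_bounded compact_continuous_image) (auto intro: continuous_on_subset)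
  then obtain B where B: "\<And>x. x \<in> C \<Longrightarrow> norm (u x) \<le> B" by (auto simp: bounded_iff)
  have "(\<integral>\<^sup>+x. ennreal (u x) \<partial>\<mu>) \<le> (\<integral>\<^sup>+x. ennreal B * indicator C x \<partial>\<mu>)"
    using B C u by (intro nn_integral_mono) (force simp: indicator_def intro: ennreal_leI)
  also have "\<dots> = ennreal B * emeasure \<mu> C"
    using C by (intro nn_integral_cmult_indicator) (auto intro: borel_closed compact_imp_closed)
  also have "\<dots> < \<infinity>" using emeasure_mu_compact[OF C(1)] by (simp add: ennreal_mult_less_top)
  finally have fin: "(\<integral>\<^sup>+x. ennreal (u x) \<partial>\<mu>) < \<infinity>" .
  then have int: "integrable \<mu> u" using u by (intro integrableI_nonneg) auto
  then show "has_bochner_integral \<mu> u (\<integral>x. u x \<partial>\<mu>)" by (rule has_bochner_integral_integrable)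
  have eq: "ennreal (infsum u \<Gamma>) = (\<integral>\<^sup>+\<gamma>. u \<gamma> \<partial>count_space \<Gamma>)" if "\<Gamma> \<in> space \<nu>" for \<Gamma>
  proof -
    have "finite (\<Gamma> \<inter> C)"
      using finite_Int_compact_if_separated[OF open_W zero_in_W separated_hull[OF that] C(1)] .
    then have "u summable_on (\<Gamma> \<inter> C)" by (rule summable_on_finite)
    then have "u summable_on \<Gamma>"
      by (rule summable_on_cong_neutral[THEN iffD1, rotated -1]) (use C in auto)
    then show ?thesis using nn_integral_count_space_eq_infsum u by metis
  qed
  show "has_bochner_integral \<nu> (\<lambda>\<Gamma>. infsum u \<Gamma>) (1 / covolume * (\<integral>x. u x \<partial>\<mu>))"
  proof (rule has_bochner_integral_nn_integral)
    have "infsum u \<Gamma> = enn2real (\<integral>\<^sup>+\<gamma>. u \<gamma> \<partial>count_space \<Gamma>)" if "\<Gamma> \<in> space \<nu>" for \<Gamma>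
      using eq[OF that] u by (metis enn2real_ennreal infsum_nonneg)
    moreover have "(\<lambda>\<Gamma>. enn2real (\<integral>\<^sup>+\<gamma>. u \<gamma> \<partial>count_space \<Gamma>)) \<in> borel_measurable \<nu>"
      using measurable_hull_sum[of "\<lambda>x. ennreal (u x)"] by measurable
    ultimately show "(\<lambda>\<Gamma>. infsum u \<Gamma>) \<in> borel_measurable \<nu>" by (simp cong: measurable_cong)
    show "AE \<Gamma> in \<nu>. 0 \<le> infsum u \<Gamma>" using u by (simp add: infsum_nonneg)
    show "0 \<le> 1 / covolume * (\<integral>x. u x \<partial>\<mu>)" using u covolume_pos by simp
    have "(\<integral>\<^sup>+\<Gamma>. ennreal (infsum u \<Gamma>) \<partial>\<nu>) = (\<integral>\<^sup>+\<Gamma>. \<integral>\<^sup>+\<gamma>. u \<gamma> \<partial>count_space \<Gamma> \<partial>\<nu>)"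
      by (intro nn_integral_cong) (rule eq)
    also have "\<dots> = ennreal (1 / covolume) * (\<integral>\<^sup>+x. u x \<partial>\<mu>)" by (intro nn_integral_hull_sum) measurable
    also have "(\<integral>\<^sup>+x. u x \<partial>\<mu>) = ennreal (\<integral>x. u x \<partial>\<mu>)" using int u by (intro nn_integral_eq_integral) auto
    finally show "(\<integral>\<^sup>+\<Gamma>. ennreal (infsum u \<Gamma>) \<partial>\<nu>) = ennreal (1 / covolume * (\<integral>x. u x \<partial>\<mu>))"
      using covolume_pos u by (subst ennreal_mult) auto
  qed
qed

text \<open>Positive and negative parts of the real and imaginary part of \<open>f\<close> are
  continuous and vanish where \<open>f\<close> does, so they reduce to the nonnegative case.\<close>

lemma integral_hull_sum_Cc:
  assumes "f \<in> Cc"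
  shows "(\<integral>\<Gamma>. (\<Sum>\<^sub>\<infinity>\<gamma>\<in>\<Gamma>. f \<gamma>) \<partial>\<nu>) = complex_of_real (1 / covolume) * (\<integral>x. f x \<partial>\<mu>)"
proof -
  define C where "C = closure {x. f x \<noteq> 0}"
  have C: "compact C" "\<And>x. x \<notin> C \<Longrightarrow> f x = 0" and f: "continuous_on UNIV f"
    using assms closure_subset[of "{x. f x \<noteq> 0}"] by (auto simp: Cc_def C_def)
  \<comment> \<open>Summability on every hull element belongs to \<open>P\<close> because
    \<open>infsum\<close> is additive only for summable functions; with it, \<open>P\<close> is
    closed under sums and complex multiples.\<close>
  define P where "P h \<longleftrightarrow> (\<forall>\<Gamma>\<in>space \<nu>. h summable_on \<Gamma>) \<and> (\<exists>I. has_bochner_integral \<mu> h I \<and>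
      has_bochner_integral \<nu> (\<lambda>\<Gamma>. infsum h \<Gamma>) (complex_of_real (1 / covolume) * I))" for h :: "'a \<Rightarrow> complex"
  have P_add: "P (\<lambda>x. h x + k x)" if "P h" "P k" for h k
  proof -
    obtain I J where I: "has_bochner_integral \<mu> h I" "has_bochner_integral \<nu> (\<lambda>\<Gamma>. infsum h \<Gamma>) (complex_of_real (1 / covolume) * I)"
      and J: "has_bochner_integral \<mu> k J" "has_bochner_integral \<nu> (\<lambda>\<Gamma>. infsum k \<Gamma>) (complex_of_real (1 / covolume) * J)"
      using \<open>P h\<close> \<open>P k\<close> unfolding P_def by blast
    have "has_bochner_integral \<nu> (\<lambda>\<Gamma>. infsum (\<lambda>x. h x + k x) \<Gamma>) (complex_of_real (1 / covolume) * (I + J))"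
      using has_bochner_integral_add[OF I(2) J(2)] that unfolding P_def ring_distribs
      by (subst has_bochner_integral_cong[OF refl infsum_add refl]) auto
    moreover have "has_bochner_integral \<mu> (\<lambda>x. h x + k x) (I + J)" using I J by auto
    ultimately show ?thesis using that summable_on_add unfolding P_def by blast
  qed
  have P_mult: "P (\<lambda>x. c * h x)" if "P h" for h c
  proof -
    obtain I where I: "has_bochner_integral \<mu> h I" "has_bochner_integral \<nu> (\<lambda>\<Gamma>. infsum h \<Gamma>) (complex_of_real (1 / covolume) * I)"
      using \<open>P h\<close> unfolding P_def by blast
    have "has_bochner_integral \<nu> (\<lambda>\<Gamma>. infsum (\<lambda>x. c * h x) \<Gamma>) (complex_of_real (1 / covolume) * (c * I))"
      using has_bochner_integral_mult_right[of c, OF I(2)] by (simp add: infsum_cmult_right' mult_ac)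
    moreover have "has_bochner_integral \<mu> (\<lambda>x. c * h x) (c * I)" using I by auto
    ultimately show ?thesis using that summable_on_cmult_right unfolding P_def by blast
  qed
  have P_nonneg: "P (\<lambda>x. complex_of_real (max 0 (v x)))"
    if v: "continuous_on UNIV v" "\<And>x. f x = 0 \<Longrightarrow> v x = 0" for v
  proof -
    define u where "u x = max 0 (v x)" for x
    have u: "continuous_on UNIV u" "\<And>x. 0 \<le> u x" "\<And>x. x \<notin> C \<Longrightarrow> u x = 0"
      unfolding u_def using v C by (auto intro!: continuous_intros)
    have "(\<lambda>x. complex_of_real (u x)) summable_on \<Gamma>" if "\<Gamma> \<in> space \<nu>" for \<Gamma>
    proof -
      have "finite (\<Gamma> \<inter> C)"
        using finite_Int_compact_if_separated[OF open_W zero_in_W separated_hull[OF that] C(1)] .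
      then have "(\<lambda>x. complex_of_real (u x)) summable_on (\<Gamma> \<inter> C)" by (rule summable_on_finite)
      then show ?thesis
        by (rule summable_on_cong_neutral[THEN iffD1, rotated -1]) (use u in auto)
    qed
    moreover have "has_bochner_integral \<nu> (\<lambda>\<Gamma>. infsum (\<lambda>x. complex_of_real (u x)) \<Gamma>)
        (complex_of_real (1 / covolume) * complex_of_real (\<integral>x. u x \<partial>\<mu>))"
      using has_bochner_integral_of_real[OF has_bochner_integral_hull_sum_nonneg(2)[OF u(1,2) C(1) u(3)], where 'a=complex]
      by (simp add: infsum_complex_of_real)
    moreover have "has_bochner_integral \<mu> (\<lambda>x. complex_of_real (u x)) (complex_of_real (\<integral>x. u x \<partial>\<mu>))"
      using has_bochner_integral_of_real[OF has_bochner_integral_hull_sum_nonneg(1)[OF u(1,2) C(1) u(3)]] .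
    ultimately show ?thesis unfolding P_def u_def by blast
  qed
  have P_real: "P (\<lambda>x. complex_of_real (v x))"
    if v: "continuous_on UNIV v" "\<And>x. f x = 0 \<Longrightarrow> v x = 0" for v
  proof -
    have "P (\<lambda>x. complex_of_real (max 0 (v x)) + (- 1) * complex_of_real (max 0 (- v x)))"
      using v by (intro P_add P_mult P_nonneg continuous_intros) auto
    moreover have "complex_of_real (max 0 (v x)) + (- 1) * complex_of_real (max 0 (- v x)) = complex_of_real (v x)" for x
      by (simp add: max_def flip: of_real_minus)
    ultimately show ?thesis by simp
  qed
  have "P (\<lambda>x. complex_of_real (Re (f x)) + \<i> * complex_of_real (Im (f x)))"
    using f by (intro P_add P_mult P_real continuous_intros) auto
  then have "P f" by (simp flip: complex_eq)
  then show ?thesis unfolding P_def by (metis has_bochner_integral_integral_eq)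
qed

text \<open>\<open>covol\<close> is a definite description. Existence is the formula for
  \<open>Cc\<close>; uniqueness follows by testing against the one function \<open>\<eta>\<close>,
  whose integral is nonzero since \<open>\<eta>\<close> is positive on an open set containing
  0.\<close>

lemma covol_eq_covolume:
  assumes \<eta>: "continuous_on UNIV \<eta>" "\<And>x. 0 \<le> \<eta> x" "\<And>x. x \<notin> Q \<Longrightarrow> \<eta> x = 0" "\<eta> 0 \<noteq> (0::real)"
  shows "covol \<mu> \<nu> = covolume" "0 < (\<integral>\<^sup>+x. \<eta> x \<partial>\<mu>)" "(\<integral>\<^sup>+x. \<eta> x \<partial>\<mu>) < \<infinity>"
proof -
  have bo: "has_bochner_integral \<mu> \<eta> (\<integral>x. \<eta> x \<partial>\<mu>)"
    using has_bochner_integral_hull_sum_nonneg(1)[OF \<eta>(1,2) compact_Q \<eta>(3)] .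
  then have int: "integrable \<mu> \<eta>" by (rule integrable.intros)
  have nn: "(\<integral>\<^sup>+x. \<eta> x \<partial>\<mu>) = ennreal (\<integral>x. \<eta> x \<partial>\<mu>)"
    using int \<eta> by (intro nn_integral_eq_integral) auto
  show pos: "0 < (\<integral>\<^sup>+x. \<eta> x \<partial>\<mu>)"
  proof (rule ccontr)
    assume "\<not> ?thesis"
    then have "AE x in \<mu>. ennreal (\<eta> x) = 0"
      using int by (subst nn_integral_0_iff_AE[symmetric]) (auto simp: zero_less_iff_neq_zero)
    then have "AE x in \<mu>. \<not> 0 < \<eta> x" by eventually_elim (simp add: ennreal_eq_0_iff not_less)
    moreover have op: "open {x. 0 < \<eta> x}" using \<eta> by (intro open_Collect_less continuous_intros)
    ultimately have "emeasure \<mu> {x. 0 < \<eta> x} = 0"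
      by (subst (asm) AE_iff_measurable[of "{x. 0 < \<eta> x}"]) auto
    moreover have "0 < emeasure \<mu> {x. 0 < \<eta> x}"
      using \<eta>(4) \<eta>(2)[of 0] by (intro emeasure_mu_open[OF op]) (auto intro!: exI[of _ 0])
    ultimately show False by simp
  qed
  show "(\<integral>\<^sup>+x. \<eta> x \<partial>\<mu>) < \<infinity>" by (simp add: nn)
  have ne: "(\<integral>x. \<eta> x \<partial>\<mu>) \<noteq> 0" using pos nn by auto
  have "{x. \<eta> x \<noteq> 0} \<subseteq> Q" using \<eta>(3) by auto
  then have "closure {x. \<eta> x \<noteq> 0} \<subseteq> Q" using compact_Q by (intro closure_minimal compact_imp_closed)
  then have "compact (closure {x. \<eta> x \<noteq> 0})"
    using compact_Int_closed[OF compact_Q closed_closure, of "{x. \<eta> x \<noteq> 0}"] by (simp add: Int_absorb1)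
  then have Cc: "(\<lambda>x. complex_of_real (\<eta> x)) \<in> Cc"
    using \<eta> by (auto simp: Cc_def intro!: continuous_intros)
  show "covol \<mu> \<nu> = covolume"
    unfolding covol_def
  proof (rule the_equality)
    show "0 < covolume \<and> (\<forall>f\<in>Cc. (\<integral>\<Gamma>. (\<Sum>\<^sub>\<infinity>\<gamma>\<in>\<Gamma>. f \<gamma>) \<partial>\<nu>) = complex_of_real (1 / covolume) * (\<integral>x. f x \<partial>\<mu>))"
      using covolume_pos integral_hull_sum_Cc by blast
    fix c assume c: "0 < c \<and> (\<forall>f\<in>Cc. (\<integral>\<Gamma>. (\<Sum>\<^sub>\<infinity>\<gamma>\<in>\<Gamma>. f \<gamma>) \<partial>\<nu>) = complex_of_real (1 / c) * (\<integral>x. f x \<partial>\<mu>))"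
    then have "complex_of_real (1 / c) * (\<integral>x. complex_of_real (\<eta> x) \<partial>\<mu>) =
        complex_of_real (1 / covolume) * (\<integral>x. complex_of_real (\<eta> x) \<partial>\<mu>)"
      using integral_hull_sum_Cc[OF Cc] Cc by metis
    then have "complex_of_real (1 / c) = complex_of_real (1 / covolume)" using ne by simp
    then have "1 / c = 1 / covolume" by (simp only: of_real_eq_iff)
    then show "c = covolume" using c covolume_pos by (simp add: field_simps)
  qed
qed

end

subsection \<open>Frame sums over the hull\<close>

text \<open>Continuity from above of the finite measure \<open>density M h\<close> along the
  complements of \<open>K n\<close>.\<close>

lemma ennreal_indicator_tail_small:
  fixes K :: "nat \<Rightarrow> 'a set"
  assumes [measurable]: "h \<in> borel_measurable M" "\<And>n. K n \<in> sets M" and fin: "(\<integral>\<^sup>+x. h x \<partial>M) < \<infinity>"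
    and K: "incseq K" "(\<Union>n. K n) = space M" and e: "0 < e"
  obtains n where "(\<integral>\<^sup>+x. h x * indicator (- K n) x \<partial>M) < e"
proof -
  let ?D = "density M h"
  have D: "emeasure ?D (space M - K n) = (\<integral>\<^sup>+x. h x * indicator (- K n) x \<partial>M)" for n
    by (subst emeasure_density) (auto intro!: nn_integral_cong simp: indicator_def)
  have "(\<lambda>n. emeasure ?D (space M - K n)) \<longlonglongrightarrow> emeasure ?D (\<Inter>n. space M - K n)"
  proof (rule Lim_emeasure_decseq)
    show "decseq (\<lambda>n. space M - K n)" using K by (auto simp: decseq_def incseq_def)
    show "emeasure ?D (space M - K n) \<noteq> \<infinity>" for n
    proof -
      have "emeasure ?D (space M - K n) \<le> (\<integral>\<^sup>+x. h x \<partial>M)"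
        unfolding D by (intro nn_integral_mono) (auto simp: indicator_def)
      then show ?thesis using fin by (auto simp: top_unique)
    qed
  qed auto
  moreover have "(\<Inter>n. space M - K n) = {}" using K by auto
  ultimately have "(\<lambda>n. \<integral>\<^sup>+x. h x * indicator (- K n) x \<partial>M) \<longlonglongrightarrow> 0"
    by (simp only: D emeasure_empty)
  then have "\<forall>\<^sub>F n in sequentially. (\<integral>\<^sup>+x. h x * indicator (- K n) x \<partial>M) < e"
    using e by (rule order_tendstoD)
  then show ?thesis using that by (auto simp: eventually_sequentially)
qed

text \<open>Choose a translate of \<open>\<Lambda>\<close> whose points in \<open>K\<close> all lie
  close to points of \<open>\<Gamma>\<close>. Each point of \<open>\<Gamma>\<close> accounts for at
  most one of them, with a small increase of \<open>\<phi>\<close>; the points outside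
  \<open>K\<close> are controlled by the tail hypothesis.\<close>

lemma cf_hull_sum_ge:
  fixes \<phi> :: "'g::{topological_group_add,t2_space} \<Rightarrow> real"
  assumes nonneg: "\<And>x. 0 \<le> \<phi> x" and usc: "\<And>b. open {x. \<phi> x < b}"
    and W: "open W" "0 \<in> W" "separated W \<Lambda>" and \<Gamma>: "\<Gamma> \<in> cf_hull \<Lambda>"
    and ge: "\<And>x. a \<le> (\<integral>\<^sup>+\<gamma>. \<phi> \<gamma> \<partial>count_space (left_translate x \<Lambda>))"
    and tail: "\<And>e. 0 < e \<Longrightarrow> \<exists>K. compact K \<and>
      (\<forall>x. (\<integral>\<^sup>+\<gamma>. ennreal (\<phi> \<gamma>) * indicator (- K) \<gamma> \<partial>count_space (left_translate x \<Lambda>)) \<le> ennreal e)"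
  shows "a \<le> (\<integral>\<^sup>+\<gamma>. \<phi> \<gamma> \<partial>count_space \<Gamma>)"
proof (rule ennreal_le_epsilon)
  fix e :: real assume "0 < e"
  then obtain K where K: "compact K"
    "\<And>x. (\<integral>\<^sup>+\<gamma>. ennreal (\<phi> \<gamma>) * indicator (- K) \<gamma> \<partial>count_space (left_translate x \<Lambda>)) \<le> ennreal (e / 2)"
    using tail[of "e / 2"] by auto
  define S where "S = \<Gamma> \<inter> K"
  have S: "finite S"
    unfolding S_def
    by (rule finite_Int_compact_if_separated[OF W(1,2) separated_cf_hull[OF W(1,3) \<Gamma>] K(1)])
  \<comment> \<open>The increases at the points of \<open>S\<close> total at most
    \<open>e / 2\<close>; the other half of \<open>e\<close> pays for the tail.\<close>
  define \<delta> where "\<delta> = e / (2 * (real (card S) + 1))"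
  have \<delta>: "0 < \<delta>" using \<open>0 < e\<close> by (simp add: \<delta>_def)
  have "real (card S) * \<delta> \<le> e / 2"
    using \<open>0 < e\<close> by (simp add: \<delta>_def field_simps)
  define V where "V s = left_translate s W \<inter> {x. \<phi> x < \<phi> s + \<delta>}" for s
  have V: "open (V s)" "s \<in> V s" for s
    using W usc \<delta> by (auto simp: V_def mem_left_translate intro: open_left_translate)
  \<comment> \<open>For an upper bound on the nearby sums over the orbit it is enough that no translate point enters
    \<open>K'\<close>: each \<open>V s\<close> holds at most one of its points by separation.\<close>
  define K' where "K' = K - (\<Union>s\<in>S. V s)"
  have "compact K'" unfolding K'_def using V by (intro compact_diff K(1)) auto
  moreover have "\<Gamma> \<inter> K' = {}" using V by (auto simp: K'_def S_def)
  ultimately obtain x where x: "left_translate x \<Lambda> \<in> {C. closed C \<and> C \<inter> K' = {}}"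
    using cf_hull_meets_orbit[OF \<Gamma> openin_chabauty_fell_miss[of K']] closed_cf_hull[OF \<Gamma>] by blast
  let ?X = "left_translate x \<Lambda>"
  \<comment> \<open>The bound uses the translate of \<open>W\<close> around \<open>s\<close> instead
    of the smaller \<open>V s\<close>, because separation limits the count on the former to
    one.\<close>
  have le: "ennreal (\<phi> \<gamma>) \<le> (\<Sum>s\<in>S. ennreal (\<phi> s + \<delta>) * indicator (left_translate s W) \<gamma>) + ennreal (\<phi> \<gamma>) * indicator (- K) \<gamma>"
    if \<gamma>: "\<gamma> \<in> ?X" for \<gamma>
  proof (cases "\<gamma> \<in> K")
    case True
    then obtain s where s: "s \<in> S" "\<gamma> \<in> V s" using x \<gamma> by (auto simp: K'_def)
    then have "ennreal (\<phi> \<gamma>) \<le> ennreal (\<phi> s + \<delta>) * indicator (left_translate s W) \<gamma>"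
      by (auto simp: V_def intro!: ennreal_leI)
    also have "\<dots> \<le> (\<Sum>s\<in>S. ennreal (\<phi> s + \<delta>) * indicator (left_translate s W) \<gamma>)"
      using s S by (intro member_le_sum) auto
    finally show ?thesis by (rule add_increasing2[rotated]) simp
  qed simp
  have "a \<le> (\<integral>\<^sup>+\<gamma>. \<phi> \<gamma> \<partial>count_space ?X)" by (rule ge)
  also have "\<dots> \<le> (\<integral>\<^sup>+\<gamma>. (\<Sum>s\<in>S. ennreal (\<phi> s + \<delta>) * indicator (left_translate s W) \<gamma>) + ennreal (\<phi> \<gamma>) * indicator (- K) \<gamma> \<partial>count_space ?X)"
    by (intro nn_integral_mono) (use le in auto)
  also have "\<dots> = (\<Sum>s\<in>S. ennreal (\<phi> s + \<delta>) * (\<integral>\<^sup>+\<gamma>. indicator (left_translate s W) \<gamma> \<partial>count_space ?X)) +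
      (\<integral>\<^sup>+\<gamma>. ennreal (\<phi> \<gamma>) * indicator (- K) \<gamma> \<partial>count_space ?X)"
    by (simp add: nn_integral_add nn_integral_sum nn_integral_cmult del: nn_integral_indicator)
  also have "\<dots> \<le> (\<Sum>s\<in>S. ennreal (\<phi> s + \<delta>) * 1) + ennreal (e / 2)"
    using separated_left_translate[OF W(3), of x] unfolding separated_iff_sum_le_1
    by (intro add_mono sum_mono mult_left_mono K(2)) auto
  also have "(\<Sum>s\<in>S. ennreal (\<phi> s + \<delta>) * 1) = ennreal (\<Sum>s\<in>S. \<phi> s) + ennreal (real (card S) * \<delta>)"
    using nonneg \<delta> by (simp add: sum_ennreal sum.distrib sum_nonneg flip: ennreal_plus)
  also have "\<dots> + ennreal (e / 2) \<le> ennreal (\<Sum>s\<in>S. \<phi> s) + ennreal (e / 2) + ennreal (e / 2)"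
    using \<open>real (card S) * \<delta> \<le> e / 2\<close> by (intro add_mono ennreal_leI) auto
  also have "\<dots> = (\<Sum>s\<in>S. ennreal (\<phi> s)) + ennreal e"
    using \<open>0 < e\<close> nonneg by (simp add: add.assoc sum_ennreal flip: ennreal_plus)
  also have "(\<Sum>s\<in>S. ennreal (\<phi> s)) = (\<integral>\<^sup>+\<gamma>. ennreal (\<phi> \<gamma>) * indicator S \<gamma> \<partial>count_space \<Gamma>)"
    using S by (subst nn_integral_count_space'[of S]) (auto simp: S_def)
  also have "\<dots> \<le> (\<integral>\<^sup>+\<gamma>. \<phi> \<gamma> \<partial>count_space \<Gamma>)"
    by (intro nn_integral_mono) (auto simp: indicator_def)
  finally show "a \<le> (\<integral>\<^sup>+\<gamma>. \<phi> \<gamma> \<partial>count_space \<Gamma>) + ennreal e" by simp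
qed

section \<open>Averaging against a bump function, and control of tails\<close>

locale haar_hull_bump = haar_hull +
  fixes \<eta> :: "'a \<Rightarrow> real"
  assumes cont_eta: "continuous_on UNIV \<eta>" and eta_nonneg: "\<And>x. 0 \<le> \<eta> x" and eta_le_1: "\<And>x. \<eta> x \<le> 1"
    and eta_outside: "\<And>x. x \<notin> Q \<Longrightarrow> \<eta> x = 0" and eta_0: "\<eta> 0 \<noteq> 0"
begin

lemma eta_meas [measurable]: "\<eta> \<in> borel_measurable borel"
  using cont_eta by (rule borel_measurable_continuous_onI)

lemma bump_integral: "0 < (\<integral>\<^sup>+x. \<eta> x \<partial>\<mu>)" "(\<integral>\<^sup>+x. \<eta> x \<partial>\<mu>) < \<infinity>"
  and covol_eq: "covol \<mu> \<nu> = covolume"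
  using covol_eq_covolume[OF cont_eta eta_nonneg eta_outside eta_0] by auto

text \<open>The functions to be summed are only Borel measurable, so their sums do not pass to limits in the
  Chabauty--Fell topology. Averaging over left translates makes them continuous, and it respects
  bounds that hold uniformly over all translates of \<open>\<Lambda>\<close>.\<close>

definition smooth :: "('a \<Rightarrow> real) \<Rightarrow> 'a \<Rightarrow> real" where
  "smooth F g = (\<integral>y. \<eta> y * F (- y + g) \<partial>\<mu>)"

context
  fixes F :: "'a \<Rightarrow> real" and B :: real
  assumes F_meas [measurable]: "F \<in> borel_measurable borel"
    and F_nonneg: "\<And>x. 0 \<le> F x" and F_le: "\<And>x. F x \<le> B"
begin

lemma smooth_nonneg: "0 \<le> smooth F g"
  unfolding smooth_def using F_nonneg eta_nonneg by (intro integral_nonneg_AE) auto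

lemma ennreal_smooth: "ennreal (smooth F g) = (\<integral>\<^sup>+y. ennreal (\<eta> y) * ennreal (F (- y + g)) \<partial>\<mu>)"
proof -
  have "(\<integral>\<^sup>+y. ennreal (\<eta> y * F (- y + g)) \<partial>\<mu>) \<le> (\<integral>\<^sup>+y. ennreal (\<eta> y) * ennreal B \<partial>\<mu>)"
    using F_nonneg F_le eta_nonneg
    by (intro nn_integral_mono) (auto simp: ennreal_mult intro!: mult_left_mono ennreal_leI)
  also have "\<dots> = (\<integral>\<^sup>+y. ennreal (\<eta> y) \<partial>\<mu>) * ennreal B" by (intro nn_integral_multc) measurable
  also have "\<dots> < \<infinity>" using bump_integral by (simp add: ennreal_mult_less_top)
  finally have "integrable \<mu> (\<lambda>y. \<eta> y * F (- y + g))"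
    using F_nonneg eta_nonneg by (intro integrableI_nonneg) auto
  then have "(\<integral>\<^sup>+y. ennreal (\<eta> y * F (- y + g)) \<partial>\<mu>) = ennreal (smooth F g)"
    unfolding smooth_def using F_nonneg eta_nonneg by (intro nn_integral_eq_integral) auto
  then show ?thesis using F_nonneg eta_nonneg by (simp add: ennreal_mult)
qed

text \<open>The substitution of \<open>g + y\<close> for \<open>y\<close> moves \<open>g\<close>
  from the merely measurable \<open>F\<close> into the continuous \<open>\<eta>\<close>, which makes
  dominated convergence available.\<close>

lemma smooth_alt: "smooth F g = (\<integral>y. \<eta> (g + y) * F (- y) \<partial>\<mu>)"
  unfolding smooth_def using \<mu>.integral_add_left[of "\<lambda>y. \<eta> y * F (- y + g)" g]
  by (simp add: minus_add add.assoc)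

lemma continuous_smooth: "continuous_on UNIV (smooth F)"
proof (intro continuous_at_imp_continuous_on ballI continuous_at_sequentiallyI)
  fix g :: 'a and u assume u: "u \<longlonglongrightarrow> g"
  \<comment> \<open>A common compact support for the integrands: if \<open>- u n = - g + w\<close>
    with \<open>w \<in> W \<subseteq> Q\<close>, then \<open>u n + y \<in> Q\<close> forces
    \<open>y = (- g + w) + (u n + y) \<in> C\<close>. This holds from index \<open>n0\<close> on,
    hence the shift.\<close>
  define C where "C = set_prod (set_prod {- g} Q) Q"
  have C: "compact C" unfolding C_def using compact_Q by (intro compact_set_prod) auto
  have "\<forall>\<^sub>F n in sequentially. - u n \<in> left_translate (- g) W"
    using zero_in_W
    by (intro topological_tendstoD[OF tendsto_minus[OF u] open_left_translate[OF open_W]])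
      (simp add: mem_left_translate)
  then obtain n0 where n0: "\<And>n. n \<ge> n0 \<Longrightarrow> - u n \<in> left_translate (- g) W"
    by (auto simp: eventually_sequentially)
  have "(\<lambda>n. \<integral>y. \<eta> (u (n + n0) + y) * F (- y) \<partial>\<mu>) \<longlonglongrightarrow> (\<integral>y. \<eta> (g + y) * F (- y) \<partial>\<mu>)"
  proof (rule integral_dominated_convergence[where w = "\<lambda>y. B * indicator C y"])
    show "integrable \<mu> (\<lambda>y. B * indicator C y)"
      using emeasure_mu_compact[OF C] C
      by (intro integrable_mult_right integrable_real_indicator) (auto intro: borel_closed compact_imp_closed)
    show "AE y in \<mu>. (\<lambda>n. \<eta> (u (n + n0) + y) * F (- y)) \<longlonglongrightarrow> \<eta> (g + y) * F (- y)"
      using LIMSEQ_ignore_initial_segment[OF u, of n0] cont_eta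
      by (intro AE_I2 tendsto_intros continuous_on_tendsto_compose[OF cont_eta]) auto
    show "AE y in \<mu>. norm (\<eta> (u (n + n0) + y) * F (- y)) \<le> B * indicator C y" for n
    proof (intro AE_I2)
      fix y
      have B: "0 \<le> B" using F_nonneg[of 0] F_le[of 0] by linarith
      show "norm (\<eta> (u (n + n0) + y) * F (- y)) \<le> B * indicator C y"
      proof (cases "y \<in> C")
        case True
        have "\<eta> (u (n + n0) + y) * F (- y) \<le> 1 * B"
          using F_nonneg F_le eta_nonneg eta_le_1 by (intro mult_mono) auto
        then show ?thesis using True F_nonneg eta_nonneg by (simp add: abs_mult)
      next
        case False
        have "u (n + n0) + y \<notin> Q"
        proof
          assume Q: "u (n + n0) + y \<in> Q"
          obtain w where w: "w \<in> W" "- u (n + n0) = - g + w"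
            using n0[of "n + n0"] by (auto simp: left_translate_def)
          have "y = (- g + w) + (u (n + n0) + y)" unfolding w(2)[symmetric] by (simp add: add.assoc[symmetric])
          then have "y \<in> C" using Q w W_subset_Q unfolding C_def set_prod_def by blast
          then show False using False by simp
        qed
        then show ?thesis using eta_outside False by simp
      qed
    qed
  qed measurable
  then have "(\<lambda>n. smooth F (u (n + n0))) \<longlonglongrightarrow> smooth F g" by (simp add: smooth_alt)
  then show "(\<lambda>n. smooth F (u n)) \<longlonglongrightarrow> smooth F g" by (rule LIMSEQ_offset)
qed

lemma open_less_smooth: "open {x. b < smooth F x}" and open_smooth_less: "open {x. smooth F x < b}"
  using open_Collect_less[OF continuous_on_const continuous_smooth]
    open_Collect_less[OF continuous_smooth continuous_on_const] by auto

lemma nn_integral_smooth: "(\<integral>\<^sup>+x. smooth F x \<partial>\<mu>) = (\<integral>\<^sup>+x. \<eta> x \<partial>\<mu>) * (\<integral>\<^sup>+x. F x \<partial>\<mu>)"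
proof -
  interpret sigma_finite_measure \<mu> by (rule sigma_finite_mu)
  interpret pair_sigma_finite \<mu> \<mu> by unfold_locales
  have "(\<integral>\<^sup>+x. smooth F x \<partial>\<mu>) = (\<integral>\<^sup>+x. \<integral>\<^sup>+y. ennreal (\<eta> y) * ennreal (F (- y + x)) \<partial>\<mu> \<partial>\<mu>)"
    by (simp add: ennreal_smooth)
  also have "\<dots> = (\<integral>\<^sup>+y. \<integral>\<^sup>+x. ennreal (\<eta> y) * ennreal (F (- y + x)) \<partial>\<mu> \<partial>\<mu>)"
    by (intro Fubini') measurable
  also have "\<dots> = (\<integral>\<^sup>+y. ennreal (\<eta> y) * (\<integral>\<^sup>+x. F x \<partial>\<mu>) \<partial>\<mu>)"
    by (simp add: nn_integral_cmult \<mu>.nn_integral_add_left[of "\<lambda>x. ennreal (F x)"])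
  finally show ?thesis by (simp add: nn_integral_multc)
qed

text \<open>A translate of \<open>\<Lambda>\<close> is countable, so sum and integral may be
  exchanged. As the average runs over left translates, the inner sums again run over translates of
  \<open>\<Lambda>\<close>.\<close>

lemma sum_smooth:
  "(\<integral>\<^sup>+\<gamma>. smooth F \<gamma> \<partial>count_space (left_translate x \<Lambda>)) =
    (\<integral>\<^sup>+y. ennreal (\<eta> y) * (\<integral>\<^sup>+\<gamma>. F \<gamma> \<partial>count_space (left_translate (- y + x) \<Lambda>)) \<partial>\<mu>)"
proof -
  have "countable (left_translate x \<Lambda>)"
    by (rule countable_if_separated[OF open_W zero_in_W separated_left_translate[OF separated_W]])
  then have "(\<integral>\<^sup>+\<gamma>. smooth F \<gamma> \<partial>count_space (left_translate x \<Lambda>)) =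
    (\<integral>\<^sup>+y. \<integral>\<^sup>+\<gamma>. ennreal (\<eta> y) * ennreal (F (- y + \<gamma>)) \<partial>count_space (left_translate x \<Lambda>) \<partial>\<mu>)"
    unfolding ennreal_smooth by (intro nn_integral_count_space_nn_integral[symmetric]) measurable
  also have "\<dots> = (\<integral>\<^sup>+y. ennreal (\<eta> y) * (\<integral>\<^sup>+\<gamma>. F \<gamma> \<partial>count_space (left_translate (- y + x) \<Lambda>)) \<partial>\<mu>)"
    by (simp add: nn_integral_cmult nn_integral_count_space_left_translate add.assoc)
  finally show ?thesis .
qed

lemma sum_smooth_le:
  assumes "\<And>x. (\<integral>\<^sup>+\<gamma>. F \<gamma> \<partial>count_space (left_translate x \<Lambda>)) \<le> C"
  shows "(\<integral>\<^sup>+\<gamma>. smooth F \<gamma> \<partial>count_space (left_translate x \<Lambda>)) \<le> (\<integral>\<^sup>+x. \<eta> x \<partial>\<mu>) * C"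
proof -
  have "(\<integral>\<^sup>+\<gamma>. smooth F \<gamma> \<partial>count_space (left_translate x \<Lambda>)) \<le> (\<integral>\<^sup>+y. ennreal (\<eta> y) * C \<partial>\<mu>)"
    unfolding sum_smooth using assms by (intro nn_integral_mono mult_left_mono) auto
  then show ?thesis by (simp add: nn_integral_multc)
qed

lemma sum_smooth_ge:
  assumes "\<And>x. C \<le> (\<integral>\<^sup>+\<gamma>. F \<gamma> \<partial>count_space (left_translate x \<Lambda>))"
  shows "(\<integral>\<^sup>+x. \<eta> x \<partial>\<mu>) * C \<le> (\<integral>\<^sup>+\<gamma>. smooth F \<gamma> \<partial>count_space (left_translate x \<Lambda>))"
proof -
  have "(\<integral>\<^sup>+y. ennreal (\<eta> y) * C \<partial>\<mu>) \<le> (\<integral>\<^sup>+\<gamma>. smooth F \<gamma> \<partial>count_space (left_translate x \<Lambda>))"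
    unfolding sum_smooth using assms by (intro nn_integral_mono mult_left_mono) auto
  then show ?thesis by (simp add: nn_integral_multc)
qed

lemma nn_integral_hull_sum_smooth:
  "(\<integral>\<^sup>+\<Gamma>. \<integral>\<^sup>+\<gamma>. smooth F \<gamma> \<partial>count_space \<Gamma> \<partial>\<nu>) = (\<integral>\<^sup>+x. \<eta> x \<partial>\<mu>) * (ennreal (1 / covolume) * (\<integral>\<^sup>+x. F x \<partial>\<mu>))"
  using borel_measurable_continuous_onI[OF continuous_smooth]
  by (subst nn_integral_hull_sum) (simp_all add: nn_integral_smooth mult_ac)

text \<open>The bound for \<open>smooth F\<close> is integrated over the hull, which has mass one.
  Both sides contain the factor \<open>\<integral>\<eta>\<close>, and cancelling it removes the bump
  function.\<close>

lemma nn_integral_le_if_sums_le: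
  assumes "\<And>x. (\<integral>\<^sup>+\<gamma>. F \<gamma> \<partial>count_space (left_translate x \<Lambda>)) \<le> C"
  shows "ennreal (1 / covolume) * (\<integral>\<^sup>+x. F x \<partial>\<mu>) \<le> C"
proof -
  have "(\<integral>\<^sup>+x. \<eta> x \<partial>\<mu>) * (ennreal (1 / covolume) * (\<integral>\<^sup>+x. F x \<partial>\<mu>)) \<le> (\<integral>\<^sup>+\<Gamma>. (\<integral>\<^sup>+x. \<eta> x \<partial>\<mu>) * C \<partial>\<nu>)"
    unfolding nn_integral_hull_sum_smooth[symmetric]
  proof (rule nn_integral_mono)
    fix \<Gamma> assume "\<Gamma> \<in> space \<nu>"
    then have \<Gamma>: "\<Gamma> \<in> cf_hull \<Lambda>" by (simp add: space_hull)
    show "(\<integral>\<^sup>+\<gamma>. smooth F \<gamma> \<partial>count_space \<Gamma>) \<le> (\<integral>\<^sup>+x. \<eta> x \<partial>\<mu>) * C"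
      by (rule cf_hull_sum_le[OF smooth_nonneg open_less_smooth \<Gamma> sum_smooth_le[OF assms]])
  qed
  also have "\<dots> = (\<integral>\<^sup>+x. \<eta> x \<partial>\<mu>) * C" by (simp add: emeasure_space_hull)
  finally show ?thesis
    using bump_integral by (subst (asm) ennreal_mult_le_mult_iff) auto
qed

lemma nn_integral_ge_if_sums_ge:
  assumes ge: "\<And>x. C \<le> (\<integral>\<^sup>+\<gamma>. F \<gamma> \<partial>count_space (left_translate x \<Lambda>))"
    and tail: "\<And>e. 0 < e \<Longrightarrow> \<exists>K. compact K \<and>
      (\<forall>x. (\<integral>\<^sup>+\<gamma>. ennreal (smooth F \<gamma>) * indicator (- K) \<gamma> \<partial>count_space (left_translate x \<Lambda>)) \<le> ennreal e)"
  shows "C \<le> ennreal (1 / covolume) * (\<integral>\<^sup>+x. F x \<partial>\<mu>)"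
proof -
  have "(\<integral>\<^sup>+x. \<eta> x \<partial>\<mu>) * C = (\<integral>\<^sup>+\<Gamma>. (\<integral>\<^sup>+x. \<eta> x \<partial>\<mu>) * C \<partial>\<nu>)" by (simp add: emeasure_space_hull)
  also have "\<dots> \<le> (\<integral>\<^sup>+x. \<eta> x \<partial>\<mu>) * (ennreal (1 / covolume) * (\<integral>\<^sup>+x. F x \<partial>\<mu>))"
    unfolding nn_integral_hull_sum_smooth[symmetric]
  proof (rule nn_integral_mono)
    fix \<Gamma> assume "\<Gamma> \<in> space \<nu>"
    then have \<Gamma>: "\<Gamma> \<in> cf_hull \<Lambda>" by (simp add: space_hull)
    show "(\<integral>\<^sup>+x. \<eta> x \<partial>\<mu>) * C \<le> (\<integral>\<^sup>+\<gamma>. smooth F \<gamma> \<partial>count_space \<Gamma>)"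
      by (rule cf_hull_sum_ge[OF smooth_nonneg open_smooth_less open_W zero_in_W separated_W \<Gamma>
            sum_smooth_ge[OF ge] tail])
  qed
  finally show ?thesis
    using bump_integral by (subst (asm) ennreal_mult_le_mult_iff) auto
qed

end

text \<open>At a point outside \<open>Q + K'\<close> the average samples \<open>F\<close> only
  outside \<open>K'\<close>, because \<open>\<eta>\<close> vanishes off \<open>Q\<close>. There
  \<open>F\<close> may be replaced by its restriction to the complement of
  \<open>K'\<close>.\<close>

lemma sum_smooth_tail_le:
  assumes [measurable]: "F \<in> borel_measurable borel" and F: "\<And>x. 0 \<le> F x" "\<And>x. F x \<le> B" and K': "compact K'"
    and le: "\<And>x. (\<integral>\<^sup>+\<gamma>. ennreal (F \<gamma>) * indicator (- K') \<gamma> \<partial>count_space (left_translate x \<Lambda>)) \<le> C"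
  shows "(\<integral>\<^sup>+\<gamma>. ennreal (smooth F \<gamma>) * indicator (- set_prod Q K') \<gamma> \<partial>count_space (left_translate x \<Lambda>))
    \<le> (\<integral>\<^sup>+x. \<eta> x \<partial>\<mu>) * C"
proof -
  define F' where "F' x = F x * indicator (- K') x" for x
  have [measurable]: "K' \<in> sets borel" using K' by (auto intro: borel_closed compact_imp_closed)
  have F'_meas[measurable]: "F' \<in> borel_measurable borel" unfolding F'_def by measurable
  have F': "0 \<le> F' x" "F' x \<le> B" for x using F[of x] by (auto simp: F'_def indicator_def)
  have "ennreal (smooth F \<gamma>) * indicator (- set_prod Q K') \<gamma> \<le> ennreal (smooth F' \<gamma>)" for \<gamma>
  proof (cases "\<gamma> \<in> set_prod Q K'")
    case False
    have "\<eta> y * F (- y + \<gamma>) = \<eta> y * F' (- y + \<gamma>)" for y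
    proof (cases "y \<in> Q")
      case True
      have "- y + \<gamma> \<notin> K'"
      proof
        assume "- y + \<gamma> \<in> K'"
        moreover have "\<gamma> = y + (- y + \<gamma>)" by (simp add: add.assoc[symmetric])
        ultimately show False using False True unfolding set_prod_def by blast
      qed
      then show ?thesis by (simp add: F'_def)
    qed (simp add: eta_outside)
    then have "smooth F \<gamma> = smooth F' \<gamma>" unfolding smooth_def by presburger
    then show ?thesis by (simp add: indicator_def)
  qed simp
  then have "(\<integral>\<^sup>+\<gamma>. ennreal (smooth F \<gamma>) * indicator (- set_prod Q K') \<gamma> \<partial>count_space (left_translate x \<Lambda>))
    \<le> (\<integral>\<^sup>+\<gamma>. smooth F' \<gamma> \<partial>count_space (left_translate x \<Lambda>))"
    by (intro nn_integral_mono) auto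
  also have "\<dots> \<le> (\<integral>\<^sup>+x. \<eta> x \<partial>\<mu>) * C"
  proof (rule sum_smooth_le[OF F'_meas F'])
    have "ennreal (F' \<gamma>) = ennreal (F \<gamma>) * indicator (- K') \<gamma>" for \<gamma> by (simp add: F'_def indicator_def)
    then show "(\<integral>\<^sup>+\<gamma>. F' \<gamma> \<partial>count_space (left_translate x \<Lambda>)) \<le> C" for x using le by simp
  qed
  finally show ?thesis .
qed

text \<open>For \<open>\<gamma>\<close> in \<open>g + W \<subseteq> g + Q\<close> the value at
  \<open>\<gamma>\<close> is bounded by the local maximum at \<open>g\<close>. For fixed
  \<open>\<gamma>\<close> such \<open>g\<close> form a left translate of the inverse of
  \<open>W\<close>, of constant measure; for fixed \<open>g\<close> at most one
  \<open>\<gamma>\<close> occurs by separation. If \<open>\<gamma>\<close> is outside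
  \<open>K' + Q\<close>, then \<open>g\<close> is outside \<open>K'\<close>.\<close>

lemma sum_tail_le_local_max:
  assumes [measurable]: "local_max Q F \<in> borel_measurable borel" and K': "compact K'"
  shows "emeasure \<mu> (uminus ` W) *
      (\<integral>\<^sup>+\<gamma>. ennreal ((cmod (F \<gamma>))\<^sup>2) * indicator (- set_prod K' Q) \<gamma> \<partial>count_space (left_translate x \<Lambda>))
    \<le> (\<integral>\<^sup>+g. (local_max Q F g)\<^sup>2 * indicator (- K') g \<partial>\<mu>)"
proof -
  define V where "V = uminus ` W"
  have "V = uminus -` W" by (force simp: V_def)
  then have V: "open V" using open_W by (simp, intro open_vimage continuous_intros)
  then have [measurable]: "V \<in> sets borel" by simp
  have [measurable]: "K' \<in> sets borel" using K' by (auto intro: borel_closed compact_imp_closed)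
  let ?X = "left_translate x \<Lambda>"
  let ?G = "\<lambda>\<gamma>. ennreal ((cmod (F \<gamma>))\<^sup>2) * indicator (- set_prod K' Q) \<gamma>"
  have sepX: "separated W ?X" by (rule separated_left_translate[OF separated_W])
  have "(\<integral>\<^sup>+g. indicator V (- \<gamma> + g) \<partial>\<mu>) = emeasure \<mu> V" for \<gamma>
    using \<mu>.nn_integral_add_left[of "indicator V" "- \<gamma>"] by simp
  then have "(\<integral>\<^sup>+g. ?G \<gamma> * indicator V (- \<gamma> + g) \<partial>\<mu>) = emeasure \<mu> V * ?G \<gamma>" for \<gamma>
    by (subst nn_integral_cmult) (auto simp: mult.commute)
  then have "emeasure \<mu> V * (\<integral>\<^sup>+\<gamma>. ?G \<gamma> \<partial>count_space ?X) =
      (\<integral>\<^sup>+\<gamma>. \<integral>\<^sup>+g. ?G \<gamma> * indicator V (- \<gamma> + g) \<partial>\<mu> \<partial>count_space ?X)"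
    by (simp add: nn_integral_cmult)
  also have "\<dots> = (\<integral>\<^sup>+g. \<integral>\<^sup>+\<gamma>. ?G \<gamma> * indicator V (- \<gamma> + g) \<partial>count_space ?X \<partial>\<mu>)"
    by (intro nn_integral_count_space_nn_integral[symmetric] countable_if_separated[OF open_W zero_in_W sepX])
      measurable
  also have "\<dots> \<le> (\<integral>\<^sup>+g. (local_max Q F g)\<^sup>2 * indicator (- K') g \<partial>\<mu>)"
  proof (rule nn_integral_mono)
    fix g
    have "(\<integral>\<^sup>+\<gamma>. ?G \<gamma> * indicator V (- \<gamma> + g) \<partial>count_space ?X) \<le>
      (\<integral>\<^sup>+\<gamma>. ((local_max Q F g)\<^sup>2 * indicator (- K') g) * indicator (left_translate g W) \<gamma> \<partial>count_space ?X)"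
    proof (rule nn_integral_mono)
      fix \<gamma>
      show "?G \<gamma> * indicator V (- \<gamma> + g) \<le> ((local_max Q F g)\<^sup>2 * indicator (- K') g) * indicator (left_translate g W) \<gamma>"
      proof (cases "\<gamma> \<notin> set_prod K' Q \<and> - \<gamma> + g \<in> V")
        case True
        then have W: "- g + \<gamma> \<in> W" using \<open>V = uminus -` W\<close> by (simp add: minus_add)
        then have Q: "- g + \<gamma> \<in> Q" using W_subset_Q by blast
        have eq: "g + (- g + \<gamma>) = \<gamma>" by (simp add: add.assoc[symmetric])
        have "g \<notin> K'"
        proof
          assume "g \<in> K'"
          then have "g + (- g + \<gamma>) \<in> set_prod K' Q" using Q unfolding set_prod_def by blast
          then show False using True eq by simp
        qed
        have "ennreal (cmod (F (g + (- g + \<gamma>)))) \<le> local_max Q F g"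
          unfolding local_max_def using Q by (rule SUP_upper)
        then have "(ennreal (cmod (F \<gamma>)))\<^sup>2 \<le> (local_max Q F g)\<^sup>2" unfolding eq by (rule power_mono) simp
        then show ?thesis using W \<open>g \<notin> K'\<close> True by (simp add: mem_left_translate ennreal_power)
      qed (auto simp: indicator_def)
    qed
    also have "\<dots> = ((local_max Q F g)\<^sup>2 * indicator (- K') g) * (\<integral>\<^sup>+\<gamma>. indicator (left_translate g W) \<gamma> \<partial>count_space ?X)"
      by (intro nn_integral_cmult) simp
    also have "\<dots> \<le> ((local_max Q F g)\<^sup>2 * indicator (- K') g) * 1"
      using sepX unfolding separated_iff_sum_le_1 by (intro mult_left_mono) auto
    finally show "(\<integral>\<^sup>+\<gamma>. ?G \<gamma> * indicator V (- \<gamma> + g) \<partial>count_space ?X) \<le> (local_max Q F g)\<^sup>2 * indicator (- K') g"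
      by simp
  qed
  finally show ?thesis unfolding V_def .
qed

lemma compact_exhaustion:
  obtains K' :: "nat \<Rightarrow> 'a set" where "\<And>n. compact (K' n)" "incseq K'" "(\<Union>n. K' n) = UNIV"
proof -
  obtain g :: "nat \<Rightarrow> 'a" where g: "(\<Union>n. left_translate (g n) W) = UNIV"
    using countable_translate_cover[OF open_W zero_in_W] .
  have "left_translate (g n) W \<subseteq> left_translate (g n) Q" for n
    using W_subset_Q by (simp add: left_translate_subset_iff)
  then have "(\<Union>n. left_translate (g n) W) \<subseteq> (\<Union>n. \<Union>i\<le>n. left_translate (g i) Q)"
    by (intro UN_mono) force+
  then have U: "(\<Union>n. \<Union>i\<le>n. left_translate (g i) Q) = UNIV" unfolding g by blast
  show ?thesis
  proof (rule that[OF _ _ U])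
    show "compact (\<Union>i\<le>n. left_translate (g i) Q)" for n
      using compact_Q by (intro compact_UN compact_left_translate) auto
    show "incseq (\<lambda>n. \<Union>i\<le>n. left_translate (g i) Q)"
      by (auto simp: incseq_def intro: order_trans)
  qed
qed

text \<open>The compact set is \<open>Q + K' n + Q\<close>: the right factor comes from the local
  maximum, the left one from averaging. Uniformity in \<open>x\<close> holds because the tail
  integral of the local maximum does not involve \<open>x\<close>.\<close>

lemma smooth_tail_small:
  assumes F[measurable]: "F \<in> borel_measurable borel" and B: "\<And>x. (cmod (F x))\<^sup>2 \<le> B"
    and lm[measurable]: "local_max Q F \<in> borel_measurable borel"
    and fin: "(\<integral>\<^sup>+g. (local_max Q F g)\<^sup>2 \<partial>\<mu>) < \<infinity>" and e: "0 < e"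
  shows "\<exists>K. compact K \<and> (\<forall>x. (\<integral>\<^sup>+\<gamma>. ennreal (smooth (\<lambda>x. (cmod (F x))\<^sup>2) \<gamma>) * indicator (- K) \<gamma>
    \<partial>count_space (left_translate x \<Lambda>)) \<le> ennreal e)"
proof -
  have "uminus ` W = uminus -` W" by force
  then have "open (uminus ` W)" using open_W by (simp, intro open_vimage continuous_intros)
  then have pos: "0 < emeasure \<mu> (uminus ` W)" using zero_in_W by (intro emeasure_mu_open) auto
  have C: "compact (uminus ` Q)"
    using compact_Q by (intro compact_continuous_image continuous_intros)
  have "emeasure \<mu> (uminus ` W) \<le> emeasure \<mu> (uminus ` Q)"
    using W_subset_Q C by (intro emeasure_mono) (auto intro: borel_closed compact_imp_closed)
  then have fin': "emeasure \<mu> (uminus ` W) < \<infinity>" using emeasure_mu_compact[OF C] by (rule le_less_trans)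
  let ?a = "\<integral>\<^sup>+x. \<eta> x \<partial>\<mu>" and ?v = "emeasure \<mu> (uminus ` W)"
  \<comment> \<open>Passing to sums divides the bound by \<open>?v\<close> and averaging multiplies
    it by \<open>?a\<close>, so exactly \<open>e\<close> remains.\<close>
  define \<epsilon> where "\<epsilon> = ?v * (ennreal e / ?a)"
  have "0 < \<epsilon>" using pos e bump_integral by (simp add: \<epsilon>_def ennreal_zero_less_mult_iff ennreal_zero_less_divide)
  obtain K' :: "nat \<Rightarrow> 'a set" where K': "\<And>n. compact (K' n)" "incseq K'" "(\<Union>n. K' n) = UNIV"
    using compact_exhaustion by metis
  obtain n where n: "(\<integral>\<^sup>+g. (local_max Q F g)\<^sup>2 * indicator (- K' n) g \<partial>\<mu>) < \<epsilon>"
  proof (rule ennreal_indicator_tail_small[of "\<lambda>g. (local_max Q F g)\<^sup>2" \<mu> K' \<epsilon>])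
    show "K' n \<in> sets \<mu>" for n using K' by (auto intro: borel_closed compact_imp_closed)
  qed (use K' fin \<open>0 < \<epsilon>\<close> in auto)
  have le: "(\<integral>\<^sup>+\<gamma>. ennreal ((cmod (F \<gamma>))\<^sup>2) * indicator (- set_prod (K' n) Q) \<gamma> \<partial>count_space (left_translate x \<Lambda>)) \<le> ennreal e / ?a" for x
  proof -
    have "?v * (\<integral>\<^sup>+\<gamma>. ennreal ((cmod (F \<gamma>))\<^sup>2) * indicator (- set_prod (K' n) Q) \<gamma> \<partial>count_space (left_translate x \<Lambda>))
        \<le> ?v * (ennreal e / ?a)"
      using order_trans[OF sum_tail_le_local_max[OF lm K'(1)] less_imp_le[OF n]] unfolding \<epsilon>_def .
    then show ?thesis using pos fin' by (subst (asm) ennreal_mult_le_mult_iff) auto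
  qed
  have "(\<integral>\<^sup>+\<gamma>. ennreal (smooth (\<lambda>x. (cmod (F x))\<^sup>2) \<gamma>) * indicator (- set_prod Q (set_prod (K' n) Q)) \<gamma>
      \<partial>count_space (left_translate x \<Lambda>)) \<le> ?a * (ennreal e / ?a)" for x
    using le B by (intro sum_smooth_tail_le compact_set_prod K'(1) compact_Q) auto
  moreover have "?a * (ennreal e / ?a) = ennreal e"
    using bump_integral by (simp add: ennreal_times_divide mult.commute ennreal_mult_divide_eq)
  ultimately show ?thesis
    using compact_set_prod[OF compact_Q compact_set_prod[OF K'(1)[of n] compact_Q]] by auto
qed

end

subsection \<open>Coefficient functions of projective representations\<close>

locale hilbert =
  fixes cs :: "complex \<Rightarrow> 'h::banach \<Rightarrow> 'h" and ip :: "'h \<Rightarrow> 'h \<Rightarrow> complex"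
  assumes hilbert: "complex_hilbert cs ip"
begin

lemma ip_add_left: "ip (x + y) z = ip x z + ip y z"
  and ip_cs_left: "ip (cs a x) y = a * ip x y"
  and ip_commute: "ip y x = cnj (ip x y)"
  and ip_self: "ip x x = complex_of_real ((norm x)\<^sup>2)"
  using hilbert unfolding complex_hilbert_def by metis+

lemma ip_add_right: "ip x (y + z) = ip x y + ip x z"
  by (metis complex_cnj_add ip_add_left ip_commute)

lemma ip_cs_right: "ip x (cs a y) = cnj a * ip x y"
  by (metis complex_cnj_mult ip_cs_left ip_commute)

lemma additive_ip: "Modules.additive (ip x)"
  by unfold_locales (rule ip_add_right)

lemma cauchy_schwarz: "cmod (ip x y) \<le> norm x * norm y"
proof (cases "y = 0")
  case True
  then show ?thesis by (simp add: Modules.additive.zero[OF additive_ip])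
next
  case False
  \<comment> \<open>The coefficient of the orthogonal projection of \<open>x\<close> onto
    \<open>y\<close>; the inequality is that the residual has nonnegative square norm.\<close>
  define a where "a = ip x y / complex_of_real ((norm y)\<^sup>2)"
  have a: "a * complex_of_real ((norm y)\<^sup>2) = ip x y" using False by (simp add: a_def)
  have "complex_of_real ((norm (x + cs (- a) y))\<^sup>2) =
      ip x x - cnj a * ip x y - a * ip y x + cnj a * (a * ip y y)"
    unfolding ip_self[symmetric] by (simp add: ip_add_left ip_add_right ip_cs_left ip_cs_right algebra_simps)
  also have "\<dots> = complex_of_real ((norm x)\<^sup>2) - a * cnj (ip x y)"
    unfolding ip_self a using ip_commute[of y x] by simp
  also have "a * cnj (ip x y) = complex_of_real ((cmod (ip x y))\<^sup>2 / (norm y)\<^sup>2)"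
    by (simp only: a_def of_real_divide complex_norm_square times_divide_eq_left)
  finally have "complex_of_real ((norm (x + cs (- a) y))\<^sup>2) =
      complex_of_real ((norm x)\<^sup>2 - (cmod (ip x y))\<^sup>2 / (norm y)\<^sup>2)"
    by (simp only: of_real_diff)
  then have "(norm (x + cs (- a) y))\<^sup>2 = (norm x)\<^sup>2 - (cmod (ip x y))\<^sup>2 / (norm y)\<^sup>2"
    by (simp only: of_real_eq_iff)
  then have "(cmod (ip x y))\<^sup>2 / (norm y)\<^sup>2 \<le> (norm x)\<^sup>2"
    using zero_le_power2[of "norm (x + cs (- a) y)"] by linarith
  then have "(cmod (ip x y))\<^sup>2 \<le> (norm x * norm y)\<^sup>2"
    using False by (simp add: divide_le_eq power_mult_distrib)
  then show ?thesis by (rule power2_le_imp_le) simp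
qed

lemma continuous_ip: "continuous_on UNIV (ip x)"
proof -
  have "Modules.additive (ip x)" by (rule additive_ip)
  moreover have "ip x (r *\<^sub>R y) = r *\<^sub>R ip x y" for r y
  proof -
    have "r *\<^sub>R y = cs (complex_of_real r) y" using hilbert by (simp add: complex_hilbert_def)
    then show ?thesis by (simp add: ip_cs_right scaleR_conv_of_real)
  qed
  ultimately have "bounded_linear (ip x)"
    using cauchy_schwarz[of x]
    by (intro bounded_linear_intro[of _ "norm x"]) (auto simp: Modules.additive.add mult.commute)
  then show ?thesis by (intro linear_continuous_on)
qed

lemma norm_unitary_op: "unitary_op cs ip U \<Longrightarrow> norm (U x) = norm x"
proof -
  assume "unitary_op cs ip U"
  then have "complex_of_real ((norm (U x))\<^sup>2) = complex_of_real ((norm x)\<^sup>2)"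
    unfolding ip_self[symmetric] by (simp add: unitary_op_def)
  then have "(norm (U x))\<^sup>2 = (norm x)\<^sup>2" by (simp only: of_real_eq_iff)
  then show ?thesis by simp
qed

text \<open>\<open>h\<close> is the preimage of \<open>f\<close> under \<open>\<pi> x\<close>. The
  cocycle contributes only a factor of modulus one, so a sum of squared coefficients of
  \<open>f\<close> over a translate of \<open>\<Lambda>\<close> is a frame sum of \<open>h\<close>
  over \<open>\<Lambda>\<close> itself, with the same norm.\<close>

lemma voice_transform_translate:
  assumes "proj_unitary_rep cs ip \<pi>"
  obtains h where "norm h = norm f"
    "\<And>l. cmod (voice_transform ip \<pi> \<psi> f (x + l)) = cmod (ip h (\<pi> l \<psi>))"
proof -
  obtain \<sigma> where U: "\<And>g. unitary_op cs ip (\<pi> g)" and \<sigma>: "\<And>a b. cmod (\<sigma> a b) = 1"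
    "\<And>a b f. \<pi> a (\<pi> b f) = cs (\<sigma> a b) (\<pi> (a + b) f)"
    using assms unfolding proj_unitary_rep_def by blast
  obtain h where h: "f = \<pi> x h" using U[of x] by (meson unitary_op_def bij_pointE)
  have "cmod (voice_transform ip \<pi> \<psi> f (x + l)) = cmod (ip h (\<pi> l \<psi>))" for l
  proof -
    have "ip h (\<pi> l \<psi>) = ip f (\<pi> x (\<pi> l \<psi>))" using U[of x] by (simp add: h unitary_op_def)
    also have "\<dots> = cnj (\<sigma> x l) * ip f (\<pi> (x + l) \<psi>)" by (simp add: \<sigma>(2) ip_cs_right)
    finally show ?thesis by (simp add: voice_transform_def norm_mult \<sigma>(1))
  qed
  moreover have "norm h = norm f" unfolding h by (rule norm_unitary_op[OF U, symmetric])
  ultimately show ?thesis using that by blast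
qed

lemma voice_transform_measurable:
  assumes "proj_unitary_rep cs ip \<pi>"
  shows "voice_transform ip \<pi> \<psi> f \<in> borel_measurable borel"
  unfolding voice_transform_def
  using assms borel_measurable_continuous_onI[OF continuous_ip]
  by (intro measurable_compose[of "\<lambda>g. \<pi> g \<psi>" borel borel "ip f"]) (auto simp: proj_unitary_rep_def)

lemma voice_transform_bound:
  assumes "proj_unitary_rep cs ip \<pi>"
  shows "(cmod (voice_transform ip \<pi> \<psi> f g))\<^sup>2 \<le> (norm f * norm \<psi>)\<^sup>2"
proof (rule power_mono)
  have "unitary_op cs ip (\<pi> g)" using assms by (simp add: proj_unitary_rep_def)
  then show "cmod (voice_transform ip \<pi> \<psi> f g) \<le> norm f * norm \<psi>"
    using cauchy_schwarz[of f "\<pi> g \<psi>"] by (simp add: voice_transform_def norm_unitary_op)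
qed simp

lemma bessel_seq_translate_sum_le:
  assumes "proj_unitary_rep cs ip \<pi>" "bessel_seq ip (\<lambda>l. \<pi> l \<psi>) \<Lambda> C"
  shows "(\<integral>\<^sup>+\<gamma>. (cmod (voice_transform ip \<pi> \<psi> f \<gamma>))\<^sup>2 \<partial>count_space (left_translate x \<Lambda>)) \<le> ennreal (C * (norm f)\<^sup>2)"
proof -
  obtain h where h: "norm h = norm f"
    "\<And>l. cmod (voice_transform ip \<pi> \<psi> f (x + l)) = cmod (ip h (\<pi> l \<psi>))"
    using voice_transform_translate[OF assms(1), of f \<psi> x] by metis
  show ?thesis
    using assms(2) h(1) unfolding bessel_seq_def nn_integral_count_space_left_translate h(2)
    by (subst nn_integral_count_space_eq_infsum) (auto intro!: ennreal_leI simp flip: h(1))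
qed

lemma lower_frame_bound_translate_sum_ge:
  assumes "proj_unitary_rep cs ip \<pi>" "lower_frame_bound ip (\<lambda>l. \<pi> l \<psi>) \<Lambda> C"
  shows "ennreal (C * (norm f)\<^sup>2) \<le> (\<integral>\<^sup>+\<gamma>. (cmod (voice_transform ip \<pi> \<psi> f \<gamma>))\<^sup>2 \<partial>count_space (left_translate x \<Lambda>))"
proof -
  obtain h where h: "norm h = norm f"
    "\<And>l. cmod (voice_transform ip \<pi> \<psi> f (x + l)) = cmod (ip h (\<pi> l \<psi>))"
    using voice_transform_translate[OF assms(1), of f \<psi> x] by metis
  show ?thesis
    using assms(2) h(1) unfolding lower_frame_bound_def nn_integral_count_space_left_translate h(2)
    by (subst nn_integral_count_space_eq_infsum) (auto intro!: ennreal_leI simp flip: h(1))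
qed

end

text \<open>Locally compact Hausdorff spaces are completely regular. The separating function is 0 at
  the identity and 1 off the interior of \<open>Q\<close>, so it is subtracted from 1.\<close>

lemma bump_function_exists:
  fixes Q :: "'g::{topological_space,t2_space,zero} set"
  assumes "locally_compact_space (euclidean :: 'g topology)" "0 \<in> interior Q"
  obtains \<eta> :: "'g \<Rightarrow> real" where "continuous_on UNIV \<eta>" "\<And>x. 0 \<le> \<eta> x" "\<And>x. \<eta> x \<le> 1"
    "\<And>x. x \<notin> Q \<Longrightarrow> \<eta> x = 0" "\<eta> 0 \<noteq> 0"
proof -
  have "Hausdorff_space (euclidean :: 'g topology)"
    using hausdorff by (auto simp: Hausdorff_space_def disjnt_def)
  then have "completely_regular_space (euclidean :: 'g topology)"
    using assms
    by (intro locally_compact_regular_imp_completely_regular_space) auto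
  moreover have "closedin euclidean (- interior Q)" "0 \<in> topspace (euclidean :: 'g topology) - (- interior Q)"
    using assms by (auto simp flip: closed_closedin)
  ultimately obtain u :: "'g \<Rightarrow> real" where u: "continuous_map euclidean (top_of_set {0..1}) u" "u 0 = 0"
    "u ` (- interior Q) \<subseteq> {1}"
    unfolding completely_regular_space_def by metis
  have cont: "continuous_on UNIV u" and range: "u x \<in> {0..1}" for x
    using u(1) by (auto simp: continuous_map_in_subtopology)
  show ?thesis
  proof (rule that[of "\<lambda>x. 1 - u x"])
    show "continuous_on UNIV (\<lambda>x. 1 - u x)" using cont by (intro continuous_intros)
    show "1 - u x = 0" if "x \<notin> Q" for x using u(3) interior_subset that by fastforce
  qed (use range u(2) in auto)
qed

text \<open>Separation quantifies over all left translates, so \<open>U\<close> may be translated to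
  contain the identity. Intersecting with the interior of \<open>Q\<close> then ties the
  neighbourhood to the local maximal function.\<close>

lemma delone_separated_nbhd:
  assumes "delone \<Lambda>" "0 \<in> interior Q"
  obtains W where "open W" "0 \<in> W" "separated W \<Lambda>" "W \<subseteq> Q"
proof -
  obtain U where U: "open U" "U \<noteq> {}" "separated U \<Lambda>" using assms by (auto simp: delone_def)
  then obtain u where u: "u \<in> U" by blast
  show ?thesis
  proof (rule that[of "left_translate (- u) U \<inter> interior Q"])
    show "open (left_translate (- u) U \<inter> interior Q)" using U open_left_translate by blast
    show "0 \<in> left_translate (- u) U \<inter> interior Q" using u assms by (simp add: mem_left_translate)
    have "separated (left_translate (- u) U) \<Lambda>"
      using U unfolding separated_def by (simp add: left_translate_left_translate)
    then show "separated (left_translate (- u) U \<inter> interior Q) \<Lambda>" by (rule separated_mono) simp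
    show "left_translate (- u) U \<inter> interior Q \<subseteq> Q" using interior_subset by blast
  qed
qed

theorem theorem3p5:
  fixes \<mu> :: "'g::{topological_group_add, second_countable_topology, t2_space} measure"
    and cs :: "complex \<Rightarrow> 'h::banach \<Rightarrow> 'h"
    and ip :: "'h \<Rightarrow> 'h \<Rightarrow> complex"
    and \<pi> :: "'g \<Rightarrow> 'h \<Rightarrow> 'h"
    and \<Lambda> :: "'g set" and \<nu> :: "'g set measure"
    and Q :: "'g set" and \<psi> :: 'h and C1 C2 :: real
  assumes "locally_compact_space (euclidean :: 'g topology)"
    and "left_haar_measure \<mu>"
    and "complex_hilbert cs ip"
    and "proj_unitary_rep cs ip \<pi>"
    and "compact Q" and "0 \<in> interior Q"
    and "delone \<Lambda>"
    and "invariant_prob_on_hull \<Lambda> \<nu>"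
  shows "(bessel_seq ip (\<lambda>l. \<pi> l \<psi>) \<Lambda> C2 \<and> C2 > 0 \<longrightarrow>
            (\<forall>f. f \<noteq> 0 \<longrightarrow>
              L2_norm_sq \<mu> (voice_transform ip \<pi> \<psi> f) / ennreal ((norm f)\<^sup>2 * covol \<mu> \<nu>)
                \<le> ennreal C2))
       \<and> (bessel_seq ip (\<lambda>l. \<pi> l \<psi>) \<Lambda> C2 \<and> C2 > 0 \<and> \<psi> \<in> B_pi \<mu> Q ip \<pi> \<and>
            lower_frame_bound ip (\<lambda>l. \<pi> l \<psi>) \<Lambda> C1 \<and> C1 > 0 \<longrightarrow>
            (\<forall>f. f \<noteq> 0 \<longrightarrow>
              L2_norm_sq \<mu> (voice_transform ip \<pi> \<psi> f) / ennreal ((norm f)\<^sup>2 * covol \<mu> \<nu>)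
                \<ge> ennreal C1))"
proof -
  interpret hilbert cs ip by unfold_locales fact
  note rep = \<open>proj_unitary_rep cs ip \<pi>\<close>
  obtain W where W: "open W" "0 \<in> W" "separated W \<Lambda>" "W \<subseteq> Q"
    using delone_separated_nbhd assms by metis
  obtain K where K: "compact K" "dense_in K \<Lambda>" using \<open>delone \<Lambda>\<close> by (auto simp: delone_def)
  obtain \<eta> :: "'g \<Rightarrow> real" where \<eta>: "continuous_on UNIV \<eta>" "\<And>x. 0 \<le> \<eta> x" "\<And>x. \<eta> x \<le> 1"
    "\<And>x. x \<notin> Q \<Longrightarrow> \<eta> x = 0" "\<eta> 0 \<noteq> 0"
    using bump_function_exists assms by metis
  interpret haar_hull_bump \<Lambda> W \<nu> \<mu> Q K \<eta>
    by unfold_locales (use assms W K \<eta> in auto)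
  define F where "F f x = (cmod (voice_transform ip \<pi> \<psi> f x))\<^sup>2" for f x
  have F: "F f \<in> borel_measurable borel" "0 \<le> F f x" "F f x \<le> (norm f * norm \<psi>)\<^sup>2" for f x
  proof -
    note voice_transform_measurable[OF rep, measurable]
    show "F f \<in> borel_measurable borel" unfolding F_def by measurable
  qed (use voice_transform_bound[OF rep] in \<open>auto simp: F_def\<close>)
  \<comment> \<open>Both sides are written as \<open>1 / (norm f)\<^sup>2\<close> times the
    quantities compared by the hull estimates, so that monotonicity of multiplication finishes and
    no extended quotient has to be manipulated.\<close>
  have scale: "L2_norm_sq \<mu> (voice_transform ip \<pi> \<psi> f) / ennreal ((norm f)\<^sup>2 * covol \<mu> \<nu>) =
      ennreal (1 / (norm f)\<^sup>2) * (ennreal (1 / covolume) * (\<integral>\<^sup>+x. F f x \<partial>\<mu>))"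
    "ennreal C = ennreal (1 / (norm f)\<^sup>2) * ennreal (C * (norm f)\<^sup>2)" if "f \<noteq> 0" for f C
  proof -
    have n: "0 < (norm f)\<^sup>2" using that by simp
    have "inverse (ennreal ((norm f)\<^sup>2 * covolume)) = ennreal (1 / (norm f)\<^sup>2 * (1 / covolume))"
      using n covolume_pos by (subst inverse_ennreal) (auto simp: divide_simps)
    also have "\<dots> = ennreal (1 / (norm f)\<^sup>2) * ennreal (1 / covolume)"
      using n covolume_pos by (subst ennreal_mult) auto
    finally show "L2_norm_sq \<mu> (voice_transform ip \<pi> \<psi> f) / ennreal ((norm f)\<^sup>2 * covol \<mu> \<nu>) =
      ennreal (1 / (norm f)\<^sup>2) * (ennreal (1 / covolume) * (\<integral>\<^sup>+x. F f x \<partial>\<mu>))"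
      by (simp add: covol_eq divide_ennreal_def L2_norm_sq_def F_def mult_ac)
    show "ennreal C = ennreal (1 / (norm f)\<^sup>2) * ennreal (C * (norm f)\<^sup>2)"
      using n by (subst ennreal_mult'[symmetric]) auto
  qed
  show ?thesis
  proof (intro conjI impI allI; elim conjE)
    fix f :: 'h assume "f \<noteq> 0" and bessel: "bessel_seq ip (\<lambda>l. \<pi> l \<psi>) \<Lambda> C2"
    have "ennreal (1 / covolume) * (\<integral>\<^sup>+x. F f x \<partial>\<mu>) \<le> ennreal (C2 * (norm f)\<^sup>2)"
      using bessel_seq_translate_sum_le[OF rep bessel] F
      by (intro nn_integral_le_if_sums_le[OF F]) (simp add: F_def)
    then show "L2_norm_sq \<mu> (voice_transform ip \<pi> \<psi> f) / ennreal ((norm f)\<^sup>2 * covol \<mu> \<nu>) \<le> ennreal C2"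
      by (subst scale(1)[OF \<open>f \<noteq> 0\<close>], subst scale(2)[OF \<open>f \<noteq> 0\<close>, of C2]) (intro mult_left_mono, auto)
  next
    fix f :: 'h assume "f \<noteq> 0" and "\<psi> \<in> B_pi \<mu> Q ip \<pi>"
      and lower: "lower_frame_bound ip (\<lambda>l. \<pi> l \<psi>) \<Lambda> C1"
    then have "wiener_L2 \<mu> Q (voice_transform ip \<pi> \<psi> f)" by (auto simp: B_pi_def)
    then have lm: "local_max Q (voice_transform ip \<pi> \<psi> f) \<in> borel_measurable borel"
      "(\<integral>\<^sup>+g. (local_max Q (voice_transform ip \<pi> \<psi> f) g)\<^sup>2 \<partial>\<mu>) < \<infinity>"
      by (auto simp: wiener_L2_def cong: measurable_cong_sets)
    have "ennreal (C1 * (norm f)\<^sup>2) \<le> ennreal (1 / covolume) * (\<integral>\<^sup>+x. F f x \<partial>\<mu>)"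
    proof (rule nn_integral_ge_if_sums_ge[OF F])
      show "ennreal (C1 * (norm f)\<^sup>2) \<le> (\<integral>\<^sup>+\<gamma>. F f \<gamma> \<partial>count_space (left_translate x \<Lambda>))" for x
        unfolding F_def by (rule lower_frame_bound_translate_sum_ge[OF rep lower])
      show "\<exists>K. compact K \<and> (\<forall>x. (\<integral>\<^sup>+\<gamma>. ennreal (smooth (F f) \<gamma>) * indicator (- K) \<gamma>
          \<partial>count_space (left_translate x \<Lambda>)) \<le> ennreal e)" if "0 < e" for e
        using smooth_tail_small[OF voice_transform_measurable[OF rep] voice_transform_bound[OF rep] lm that]
        unfolding F_def .
    qed
    then show "ennreal C1 \<le> L2_norm_sq \<mu> (voice_transform ip \<pi> \<psi> f) / ennreal ((norm f)\<^sup>2 * covol \<mu> \<nu>)"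
      by (subst scale(1)[OF \<open>f \<noteq> 0\<close>], subst scale(2)[OF \<open>f \<noteq> 0\<close>, of C1]) (intro mult_left_mono, auto)
  qed
qed

end
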